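(* Let $d\geq2$, let $\rho$ be any polyhedral norm on $\mathbb{R}^d$, and fix $\varepsilon>0$. Let $F_\varepsilon$ be the log-sum-exp regularization of $\rho$ and, for $\alpha\in\mathbb{R}^d$, let $$\varphi_\alpha^\varepsilon(x)=F_\varepsilon(x)-F_\varepsilon(\alpha)-\langle\nabla F_\varepsilon(\alpha),x-\alpha\rangle,\qquad x\in\mathbb{R}^d.$$ Suppose that $\boldsymbol{\alpha}=(\alpha_1,\ldots,\alpha_d)\in(\mathbb{R}^d)^d$ is chosen so that $\nabla F_\varepsilon(\alpha_1),\ldots,\nabla F_\varepsilon(\alpha_d)$ are affinely independent. Then $\{\varphi_{\alpha_1}^\varepsilon,\ldots,\varphi_{\alpha_d}^\varepsilon\}$ is admissible on $\mathbb{R}^d$, and every critical point of its encoding map is fold non-degenerate. In particular, if $E\subseteq\mathbb{R}^d$ is a Borel $1$-rectifiable set satisfying $\mathcal{H}^1(E)>0$, then there exists $j\in\{1,\ldots,d\}$ such that $$\mathcal{H}^1\big(\varphi_{\alpha_j}^\varepsilon(E)\big)>0.$$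
   Context: A polyhedral norm is a norm $\rho$ on $\mathbb{R}^d$ whose closed unit ball $P=\{z:\rho(z)\le1\}$ is a (compact, convex, centrally symmetric) polytope. Its polar polytope is $P^\circ=\{\xi\in\mathbb{R}^d:\langle\xi,x\rangle\le1\ \text{for every }x\in P\}$, with vertices $u_1,\ldots,u_N$, so that $\rho(z)=\max_{1\le r\le N}\langle u_r,z\rangle$. The log-sum-exp regularization is $$F_\varepsilon(z)=\varepsilon\log\Big(\frac1N\sum_{r=1}^N\exp\big(\langle u_r,z\rangle/\varepsilon\big)\Big).$$ For a family $\{\varphi_1,\ldots,\varphi_d\}$ of $C^2$ functions on $\mathbb{R}^d$, the encoding map is $\mathsf{H}=(\varphi_1,\ldots,\varphi_d)$, the critical points are the points of $\Sigma=\{x\in\mathbb{R}^d:\operatorname{rank}D_x\mathsf{H}(x)\le d-1\}$, and $J=\det D_x\mathsf{H}$. The family is admissible if there is a $C^1$ embedded $(d-1)$-dimensional submanifold $M\subset\mathbb{R}^d$ (possibly empty) with $\Sigma\subseteq M$ and $\operatorname{rank}(D_x\mathsf{H}(x)|_{T_xM})=d-1$ for every $x\in M$. A critical point $x$ is fold non-degenerate if $\operatorname{rank}D_x\mathsf{H}(x)=d-1$ and $D_xJ(x)[v]\neq0$ for every $v\in\ker D_x\mathsf{H}(x)\setminus\{0\}$. $\mathcal{H}^1$ is $1$-dimensional Hausdorff measure. A Borel set $E\subseteq\mathbb{R}^d$ is $1$-rectifiable if there are Lipschitz maps $f_j:\mathbb{R}\to\mathbb{R}^d$, $j\in\mathbb{N}$,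 with $\mathcal{H}^1(E\setminus\bigcup_j f_j(\mathbb{R}))=0$. *)

theory Defs
  imports "HOL-Analysis.Analysis"
begin

section \<open>Polyhedral norms and their log-sum-exp regularization\<close>

definition is_norm :: "('a::real_vector \<Rightarrow> real) \<Rightarrow> bool" where
  "is_norm \<rho> \<longleftrightarrow>
     (\<forall>x. 0 \<le> \<rho> x) \<and> (\<forall>x. \<rho> x = 0 \<longleftrightarrow> x = 0) \<and>
     (\<forall>c x. \<rho> (c *\<^sub>R x) = \<bar>c\<bar> * \<rho> x) \<and> (\<forall>x y. \<rho> (x + y) \<le> \<rho> x + \<rho> y)"

definition unit_ball :: "('a \<Rightarrow> real) \<Rightarrow> 'a set" where
  "unit_ball \<rho> = {z. \<rho> z \<le> 1}"

definition polyhedral_norm :: "('a::real_vector \<Rightarrow> real) \<Rightarrow> bool" where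
  "polyhedral_norm \<rho> \<longleftrightarrow> is_norm \<rho> \<and> polytope (unit_ball \<rho>)"

definition polar_set :: "'a::real_inner set \<Rightarrow> 'a set" where
  "polar_set P = {\<xi>. \<forall>x\<in>P. \<xi> \<bullet> x \<le> 1}"

definition polar_vertices :: "('a::real_inner \<Rightarrow> real) \<Rightarrow> 'a set" where
  "polar_vertices \<rho> = {u. u extreme_point_of polar_set (unit_ball \<rho>)}"

definition logsumexp :: "('a::real_inner \<Rightarrow> real) \<Rightarrow> real \<Rightarrow> 'a \<Rightarrow> real" where
  "logsumexp \<rho> \<epsilon> z =
     \<epsilon> * ln (1 / real (card (polar_vertices \<rho>)) * (\<Sum>u\<in>polar_vertices \<rho>. exp ((u \<bullet> z) / \<epsilon>)))"

text \<open>Meaningful at points of differentiability only.\<close>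

definition gradient :: "('a::real_inner \<Rightarrow> real) \<Rightarrow> 'a \<Rightarrow> 'a" where
  "gradient f x = (THE D. GDERIV f x :> D)"

definition bregman :: "('a::real_inner \<Rightarrow> real) \<Rightarrow> 'a \<Rightarrow> 'a \<Rightarrow> real" where
  "bregman F \<alpha> x = F x - F \<alpha> - gradient F \<alpha> \<bullet> (x - \<alpha>)"

text \<open>Affine independence of a family, as opposed to that of its set of values: repetitions
  are excluded.\<close>

definition affinely_independent_family :: "('i \<Rightarrow> 'a::real_vector) \<Rightarrow> bool" where
  "affinely_independent_family g \<longleftrightarrow> inj g \<and> \<not> affine_dependent (range g)"


section \<open>Continuously differentiable maps and submanifolds\<close>

text \<open>These two notions are intended for open sets \<open>S\<close>.\<close>

definition C1_on :: "'a::real_normed_vector set \<Rightarrow> ('a \<Rightarrow> 'b::real_normed_vector) \<Rightarrow> bool" where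
  "C1_on S f \<longleftrightarrow>
     (\<exists>f'. (\<forall>x\<in>S. (f has_derivative blinfun_apply (f' x)) (at x)) \<and> continuous_on S f')"

definition C2_on :: "'a::real_normed_vector set \<Rightarrow> ('a \<Rightarrow> 'b::real_normed_vector) \<Rightarrow> bool" where
  "C2_on S f \<longleftrightarrow>
     (\<exists>f'. (\<forall>x\<in>S. (f has_derivative blinfun_apply (f' x)) (at x)) \<and> C1_on S f')"

text \<open>Slice charts: near each of its points, \<open>M\<close> is straightened to a \<open>k\<close>-dimensional
  linear subspace by a \<open>C\<^sup>1\<close> diffeomorphism \<open>\<psi>\<close> between open sets of the ambient space.\<close>

definition C1_submanifold :: "nat \<Rightarrow> 'a::euclidean_space set \<Rightarrow> bool" where
  "C1_submanifold k M \<longleftrightarrow>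
     (\<forall>p\<in>M. \<exists>U V \<psi> \<psi>' S.
        open U \<and> p \<in> U \<and> open V \<and> homeomorphism U V \<psi> \<psi>' \<and> C1_on U \<psi> \<and> C1_on V (\<psi>' :: 'a \<Rightarrow> 'a) \<and>
        subspace S \<and> dim S = k \<and> \<psi> ` (M \<inter> U) = V \<inter> S)"

text \<open>Velocities at \<open>x\<close> of \<open>C\<^sup>1\<close> curves in \<open>M\<close>.\<close>

definition tangent_space :: "'a::real_normed_vector set \<Rightarrow> 'a \<Rightarrow> 'a set" where
  "tangent_space M x =
     {v. \<exists>\<gamma> e. e > 0 \<and> C1_on {-e<..<e} \<gamma> \<and> \<gamma> ` {-e<..<e} \<subseteq> M \<and> \<gamma> 0 = x \<and>
           (\<gamma> has_vector_derivative v) (at (0::real))}"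


section \<open>Encoding maps\<close>

text \<open>A family of \<open>d\<close> functions on \<open>\<real>\<^sup>d\<close> is indexed by the same finite type
  \<open>'n\<close>, with \<open>CARD('n) = d\<close>, as the coordinates.\<close>

definition encoding_map :: "('n \<Rightarrow> real^'n \<Rightarrow> real) \<Rightarrow> real^'n \<Rightarrow> real^'n" where
  "encoding_map \<phi> x = (\<chi> i. \<phi> i x)"

definition critical_points :: "('n::finite \<Rightarrow> real^'n \<Rightarrow> real) \<Rightarrow> (real^'n) set" where
  "critical_points \<phi> = {x. rank (jacobian (encoding_map \<phi>) (at x)) \<le> CARD('n) - 1}"

definition jac_det :: "('n::finite \<Rightarrow> real^'n \<Rightarrow> real) \<Rightarrow> real^'n \<Rightarrow> real" where
  "jac_det \<phi> x = det (jacobian (encoding_map \<phi>) (at x))"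

definition admissible :: "('n::finite \<Rightarrow> real^'n \<Rightarrow> real) \<Rightarrow> bool" where
  "admissible \<phi> \<longleftrightarrow>
     (\<forall>i. C2_on UNIV (\<phi> i)) \<and>
     (\<exists>M. C1_submanifold (CARD('n) - 1) M \<and> critical_points \<phi> \<subseteq> M \<and>
        (\<forall>x\<in>M. dim ((\<lambda>v. jacobian (encoding_map \<phi>) (at x) *v v) ` tangent_space M x)
                 = CARD('n) - 1))"

definition fold_nondegenerate :: "('n::finite \<Rightarrow> real^'n \<Rightarrow> real) \<Rightarrow> real^'n \<Rightarrow> bool" where
  "fold_nondegenerate \<phi> x \<longleftrightarrow>
     rank (jacobian (encoding_map \<phi>) (at x)) = CARD('n) - 1 \<and>
     (\<forall>v. jacobian (encoding_map \<phi>) (at x) *v v = 0 \<and> v \<noteq> 0 \<longrightarrow>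
          frechet_derivative (jac_det \<phi>) (at x) v \<noteq> 0)"


section \<open>One-dimensional Hausdorff measure and rectifiability\<close>

text \<open>Covering sets are required to be bounded because \<^const>\<open>diameter\<close> is a real number,
  and so does not record an infinite diameter.\<close>

definition hausdorff1_content :: "real \<Rightarrow> 'a::metric_space set \<Rightarrow> ennreal" where
  "hausdorff1_content \<delta> E =
     (INF U \<in> {U :: nat \<Rightarrow> 'a set. E \<subseteq> (\<Union>i. U i) \<and> (\<forall>i. bounded (U i) \<and> diameter (U i) \<le> \<delta>)}.
        \<Sum>i. ennreal (diameter (U i)))"

definition hausdorff1 :: "'a::metric_space set \<Rightarrow> ennreal" where
  "hausdorff1 E = (SUP \<delta> \<in> {0<..}. hausdorff1_content \<delta> E)"

definition rectifiable1 :: "'a::metric_space set \<Rightarrow> bool" where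
  "rectifiable1 E \<longleftrightarrow>
     E \<in> sets borel \<and>
     (\<exists>f :: nat \<Rightarrow> real \<Rightarrow> 'a. (\<forall>j. \<exists>L. L-lipschitz_on UNIV (f j)) \<and>
        hausdorff1 (E - (\<Union>j. range (f j))) = 0)"

end

theory Submission
  imports Defs
begin

text \<open>
  The gradient \<open>m = \<nabla>F\<^sub>\<epsilon>\<close> is the mean of the polar vertices under the exponential weights, and the
  Hessian is \<open>1/\<epsilon>\<close> times their covariance. It is positive definite because the polar vertices lie on no
  common hyperplane. The Jacobian matrix of the encoding map has rows \<open>m(x) - m(\<alpha>\<^sub>i)\<close>, so by affine
  independence \<open>J(x) = w \<bullet> m(x) - c\<close>, where \<open>w\<close> is a normal of the hyperplane through the \<open>m(\<alpha>\<^sub>i)\<close>;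
  on \<open>J = 0\<close> the kernel of the Jacobian matrix is spanned by \<open>w\<close>. As the derivative of \<open>J\<close> along \<open>w\<close> is a
  value of the Hessian form at \<open>w\<close>, it is positive: the critical set is a regular level set, its
  tangent spaces do not contain \<open>w\<close>, and all critical points are folds.

  Suppose that all \<open>\<phi>\<^sub>j(E)\<close> are null. Along a Lipschitz curve, the integrability of the Banach
  indicatrix of each coordinate shows that the part of \<open>E\<close> on the curve has a null image under the
  encoding map; no differentiability of the curve is needed. The encoding map expands distances by a
  positive factor locally off the critical set, where its derivative is injective, and also locally
  within it, where \<open>J\<close> vanishes and \<open>(H, J)\<close> has injective derivative. So \<open>E\<close> itself is null.
\<close>

section \<open>Null sets of one-dimensional Hausdorff measure\<close>

lemma hausdorff1_mono:
  assumes "E \<subseteq> F"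
  shows "hausdorff1 E \<le> hausdorff1 F"
  unfolding hausdorff1_def hausdorff1_content_def
  by (intro SUP_mono' INF_superset_mono) (use assms in auto)

lemma hausdorff1_null_subset:
  assumes "hausdorff1 F = 0" "E \<subseteq> F"
  shows "hausdorff1 E = 0"
  using hausdorff1_mono[OF assms(2)] assms(1) by simp

text \<open>For null sets the mesh condition comes for free: a cover of total diameter at most
  \<open>min e \<delta>\<close> has no member of diameter above \<open>\<delta>\<close>.\<close>

lemma hausdorff1_eq_0_iff:
  "hausdorff1 E = 0 \<longleftrightarrow>
     (\<forall>e>0. \<exists>U::nat \<Rightarrow> _. E \<subseteq> (\<Union>i. U i) \<and> (\<forall>i. bounded (U i)) \<and> (\<Sum>i. ennreal (diameter (U i))) \<le> ennreal e)"
  (is "_ = ?R")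
proof
  assume 0: "hausdorff1 E = 0"
  show ?R
  proof (intro allI impI)
    fix e :: real assume "e > 0"
    have "hausdorff1_content 1 E \<le> hausdorff1 E"
      unfolding hausdorff1_def by (rule SUP_upper) simp
    then have "hausdorff1_content 1 E < ennreal e"
      using 0 \<open>e > 0\<close> by simp
    then show "\<exists>U::nat \<Rightarrow> _. E \<subseteq> (\<Union>i. U i) \<and> (\<forall>i. bounded (U i)) \<and> (\<Sum>i. ennreal (diameter (U i))) \<le> ennreal e"
      unfolding hausdorff1_content_def INF_less_iff by (force intro: less_imp_le)
  qed
next
  assume R: ?R
  have "hausdorff1_content \<delta> E = 0" if "\<delta> > 0" for \<delta>
  proof -
    have "hausdorff1_content \<delta> E \<le> 0 + ennreal e" if "e > 0" for e
    proof -
      have "min e \<delta> > 0" using \<open>\<delta> > 0\<close> \<open>e > 0\<close> by simp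
      with R obtain U :: "nat \<Rightarrow> _" where U: "E \<subseteq> (\<Union>i. U i)" "\<And>i. bounded (U i)"
        "(\<Sum>i. ennreal (diameter (U i))) \<le> ennreal (min e \<delta>)"
        by metis
      have "ennreal (diameter (U i)) \<le> ennreal (min e \<delta>)" for i
        using U(3) sum_le_suminf[of "\<lambda>i. ennreal (diameter (U i))" "{i}"] by (auto intro: order_trans)
      then have "diameter (U i) \<le> \<delta>" for i
        by (smt (verit) ennreal_le_iff \<open>min e \<delta> > 0\<close>)
      with U have "hausdorff1_content \<delta> E \<le> (\<Sum>i. ennreal (diameter (U i)))"
        unfolding hausdorff1_content_def by (intro INF_lower) auto
      also have "\<dots> \<le> ennreal e"
        using U(3) by (rule order_trans) (simp add: ennreal_leI)
      finally show ?thesis by simp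
    qed
    then have "hausdorff1_content \<delta> E \<le> 0"
      by (rule ennreal_le_epsilon)
    then show ?thesis by simp
  qed
  then show "hausdorff1 E = 0"
    unfolding hausdorff1_def by (simp add: SUP_eq_const)
qed

lemma hausdorff1_null_UN:
  fixes E :: "nat \<Rightarrow> 'a::metric_space set"
  assumes "\<And>n. hausdorff1 (E n) = 0"
  shows "hausdorff1 (\<Union>n. E n) = 0"
  unfolding hausdorff1_eq_0_iff
proof (intro allI impI)
  fix e :: real assume "e > 0"
  have "\<exists>U::nat \<Rightarrow> _. E n \<subseteq> (\<Union>i. U i) \<and> (\<forall>i. bounded (U i)) \<and>
      (\<Sum>i. ennreal (diameter (U i))) \<le> ennreal (e * (1/2)^Suc n)" for n
    using assms[of n, unfolded hausdorff1_eq_0_iff, rule_format, of "e * (1/2)^Suc n"] \<open>e > 0\<close> by simp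
  then obtain U :: "nat \<Rightarrow> nat \<Rightarrow> _" where U: "\<And>n. E n \<subseteq> (\<Union>i. U n i)" "\<And>n i. bounded (U n i)"
      "\<And>n. (\<Sum>i. ennreal (diameter (U n i))) \<le> ennreal (e * (1/2)^Suc n)"
    by metis
  define W where "W k = (case prod_decode k of (n, i) \<Rightarrow> U n i)" for k
  have "(\<Sum>k. ennreal (diameter (W k))) = (\<Sum>k. (\<lambda>(n,i). ennreal (diameter (U n i))) (prod_decode k))"
    by (simp add: W_def case_prod_beta)
  also have "\<dots> = (\<Sum>n. \<Sum>i. ennreal (diameter (U n i)))"
    by (rule suminf_ennreal_2dimen) simp
  also have "\<dots> \<le> (\<Sum>n. ennreal (e * (1/2)^Suc n))"
    using U(3) by (intro suminf_le) auto
  also have "\<dots> = ennreal e"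
    using sums_mult[OF power_half_series, of e] \<open>e > 0\<close>
    by (intro suminf_ennreal_eq) auto
  finally have "(\<Sum>k. ennreal (diameter (W k))) \<le> ennreal e" .
  moreover have "(\<Union>n. E n) \<subseteq> (\<Union>k. W k)"
  proof
    fix x assume "x \<in> (\<Union>n. E n)"
    then obtain n i where "x \<in> U n i" using U(1) by blast
    then have "x \<in> W (prod_encode (n, i))" by (simp add: W_def)
    then show "x \<in> (\<Union>k. W k)" by blast
  qed
  moreover have "bounded (W k)" for k
    by (simp add: W_def U(2) split: prod.split)
  ultimately show "\<exists>U::nat \<Rightarrow> _. (\<Union>n. E n) \<subseteq> (\<Union>i. U i) \<and> (\<forall>i. bounded (U i)) \<and>
      (\<Sum>i. ennreal (diameter (U i))) \<le> ennreal e"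
    by blast
qed

lemma hausdorff1_null_countable_UN:
  assumes "countable I" "\<And>i. i \<in> I \<Longrightarrow> hausdorff1 (E i) = 0"
  shows "hausdorff1 (\<Union>i\<in>I. E i) = 0"
proof (cases "I = {}")
  case True
  then show ?thesis
    by (auto simp: hausdorff1_eq_0_iff intro!: exI[of _ "\<lambda>_. {}"])
next
  case False
  have "hausdorff1 (\<Union>n. E (from_nat_into I n)) = 0"
    by (intro hausdorff1_null_UN assms from_nat_into False)
  then show ?thesis
    using False assms(1) range_from_nat_into by (metis image_image)
qed

lemma hausdorff1_null_Un:
  assumes "hausdorff1 E = 0" "hausdorff1 F = 0"
  shows "hausdorff1 (E \<union> F) = 0"
  using hausdorff1_null_countable_UN[of "{E, F}" "\<lambda>x. x"] assms by auto

text \<open>On the image of \<open>E\<close> the inverse of \<open>f\<close> is Lipschitz with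
  constant \<open>1 / c\<close>, so covers pull back with diameters scaled by at most that
  factor.\<close>

lemma hausdorff1_null_expanding:
  fixes E :: "'a::real_normed_vector set" and f :: "'a \<Rightarrow> 'b::metric_space"
  assumes "c > 0" and "\<And>x y. x \<in> E \<Longrightarrow> y \<in> E \<Longrightarrow> c * dist x y \<le> dist (f x) (f y)"
    and "hausdorff1 (f ` E) = 0"
  shows "hausdorff1 E = 0"
  unfolding hausdorff1_eq_0_iff
proof (intro allI impI)
  fix e :: real assume "e > 0"
  then obtain U :: "nat \<Rightarrow> _" where U: "f ` E \<subseteq> (\<Union>i. U i)" "\<And>i. bounded (U i)"
      "(\<Sum>i. ennreal (diameter (U i))) \<le> ennreal (c * e)"
    using assms(1,3) unfolding hausdorff1_eq_0_iff by (metis mult_pos_pos)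
  define W where "W i = E \<inter> f -` U i" for i
  have d: "dist x y \<le> diameter (U i) / c" if "x \<in> W i" "y \<in> W i" for i x y
  proof -
    have "c * dist x y \<le> diameter (U i)"
      using that assms(2)[of x y] diameter_bounded_bound[OF U(2), of "f x" i "f y"] by (auto simp: W_def)
    then show ?thesis using \<open>c > 0\<close> by (simp add: field_simps)
  qed
  have "bounded (W i)" for i
    unfolding bounded_two_points using d by blast
  moreover have "(\<Sum>i. ennreal (diameter (W i))) \<le> ennreal e"
  proof -
    have "diameter (W i) \<le> 1 / c * diameter (U i)" for i
      using d \<open>c > 0\<close> diameter_ge_0[OF U(2)] by (intro diameter_le) (auto simp: dist_norm)
    then have "(\<Sum>i. ennreal (diameter (W i))) \<le> (\<Sum>i. ennreal (1 / c) * ennreal (diameter (U i)))"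
      using \<open>c > 0\<close> by (intro suminf_le) (auto simp: ennreal_mult'[symmetric] intro!: ennreal_leI)
    also have "\<dots> = ennreal (1 / c) * (\<Sum>i. ennreal (diameter (U i)))"
      by simp
    also have "\<dots> \<le> ennreal (1 / c) * ennreal (c * e)"
      by (intro mult_left_mono U) auto
    also have "\<dots> = ennreal e"
      using \<open>c > 0\<close> \<open>e > 0\<close> by (simp add: ennreal_mult[symmetric])
    finally show ?thesis .
  qed
  moreover have "E \<subseteq> (\<Union>i. W i)"
    using U(1) unfolding W_def by blast
  ultimately show "\<exists>U::nat \<Rightarrow> _. E \<subseteq> (\<Union>i. U i) \<and> (\<forall>i. bounded (U i)) \<and>
      (\<Sum>i. ennreal (diameter (U i))) \<le> ennreal e"
    by blast
qed

text \<open>A bounded set of reals lies in the ball about any of its points with radius its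
  diameter, an interval of twice that length; this doubling is why the cover is taken with total
  diameter \<open>e / 2\<close>.\<close>

lemma hausdorff1_null_imp_negligible:
  fixes Z :: "real set"
  assumes "hausdorff1 Z = 0"
  shows "negligible Z"
  unfolding negligible_outer_le
proof (intro allI impI)
  fix e :: real assume "e > 0"
  then obtain U :: "nat \<Rightarrow> _" where U: "Z \<subseteq> (\<Union>i. U i)" "\<And>i. bounded (U i)"
      "(\<Sum>i. ennreal (diameter (U i))) \<le> ennreal (e / 2)"
    using assms unfolding hausdorff1_eq_0_iff by (metis half_gt_zero)
  have "\<exists>c. U i \<subseteq> cball c (diameter (U i))" for i
    using diameter_bounded_bound[OF U(2)] by (metis subsetI mem_cball ex_in_conv empty_subsetI)
  then obtain c where c: "\<And>i. U i \<subseteq> cball (c i) (diameter (U i))"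
    by metis
  define T where "T = (\<Union>i. cball (c i) (diameter (U i)))"
  have "Z \<subseteq> T" using U(1) c unfolding T_def by blast
  have "emeasure lborel T \<le> (\<Sum>i. emeasure lborel (cball (c i) (diameter (U i))))"
    unfolding T_def by (rule emeasure_subadditive_countably) auto
  also have "\<dots> = (\<Sum>i. ennreal 2 * ennreal (diameter (U i)))"
  proof (rule suminf_cong)
    fix i
    show "emeasure lborel (cball (c i) (diameter (U i))) = ennreal 2 * ennreal (diameter (U i))"
      using diameter_ge_0[OF U(2), of i]
      by (simp add: cball_eq_atLeastAtMost ennreal_mult'[symmetric] del: ennreal_numeral)
  qed
  also have "\<dots> = ennreal 2 * (\<Sum>i. ennreal (diameter (U i)))"
    by (rule ennreal_suminf_cmult)
  also have "\<dots> \<le> ennreal 2 * ennreal (e / 2)"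
    by (intro mult_left_mono U) auto
  also have "\<dots> = ennreal e"
    using \<open>e > 0\<close> by (simp add: ennreal_mult[symmetric] del: ennreal_numeral)
  finally have le: "emeasure lborel T \<le> ennreal e" .
  have T: "T \<in> sets borel" unfolding T_def by auto
  have "emeasure lebesgue T \<le> ennreal e"
    using le T by simp
  then have "T \<in> lmeasurable" "measure lebesgue T \<le> e"
    using T \<open>e > 0\<close> by (auto simp: fmeasurable_def measure_def enn2real_leI intro: le_less_trans)
  with \<open>Z \<subseteq> T\<close> show "\<exists>T. Z \<subseteq> T \<and> T \<in> lmeasurable \<and> measure lebesgue T \<le> e"
    by blast
qed

section \<open>The Banach indicatrix of a Lipschitz function\<close>

text \<open>As \<open>n\<close> grows, this increases to the number of solutions of \<open>g t = y\<close> in \<open>I\<close>, the Banach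
  indicatrix of \<open>g\<close>.\<close>

definition dyadic_crossings :: "(real \<Rightarrow> real) \<Rightarrow> real set \<Rightarrow> nat \<Rightarrow> real \<Rightarrow> nat" where
  "dyadic_crossings g I n y = card ((\<lambda>t. \<lfloor>2^n * t\<rfloor>) ` {t \<in> I. g t = y})"

lemma floor_double_div: "\<lfloor>2 ^ Suc n * t\<rfloor> div 2 = \<lfloor>2 ^ n * (t::real)\<rfloor>"
proof -
  have "\<lfloor>(2 * (2 ^ n * t)) / real_of_int 2\<rfloor> = \<lfloor>2 * (2 ^ n * t)\<rfloor> div 2"
    by (rule floor_divide_real_eq_div) simp
  then show ?thesis by (simp add: mult.assoc)
qed

lemma finite_floor_image: "finite ((\<lambda>t::real. \<lfloor>2^n * t\<rfloor>) ` {t \<in> {a..b}. P t})"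
proof (rule finite_subset)
  show "(\<lambda>t::real. \<lfloor>2^n * t\<rfloor>) ` {t \<in> {a..b}. P t} \<subseteq> {\<lfloor>2^n * a\<rfloor>..\<lfloor>2^n * b\<rfloor>}"
    by (auto intro!: floor_mono mult_left_mono)
qed simp

text \<open>Halving sends the indices of the dyadic cells hit at level \<open>Suc n\<close> onto
  those at level \<open>n\<close>, so refinement cannot lower the count.\<close>

lemma dyadic_crossings_mono:
  "dyadic_crossings g {a..b} n y \<le> dyadic_crossings g {a..b} (Suc n) y"
proof -
  have "(\<lambda>t. \<lfloor>2^n * t\<rfloor>) ` {t \<in> {a..b}. g t = y} = (\<lambda>k. k div 2) ` (\<lambda>t. \<lfloor>2^Suc n * t\<rfloor>) ` {t \<in> {a..b}. g t = y}"
    by (simp only: image_image floor_double_div)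
  then show ?thesis
    unfolding dyadic_crossings_def by (simp only:) (rule card_image_le[OF finite_floor_image])
qed

lemma is_interval_floor_preimage: "is_interval {t \<in> {a..b}. \<lfloor>2^n * t\<rfloor> = (k::int)}" for a b :: real
proof -
  have "{t \<in> {a..b}. \<lfloor>2^n * t\<rfloor> = k} = {a..b} \<inter> {of_int k / 2^n..<(of_int k + 1) / 2^n}"
    by (auto simp: floor_eq_iff field_simps)
  then show ?thesis
    by (simp add: is_interval_Int is_interval_cc is_interval_co)
qed

lemma continuous_image_interval_borel:
  fixes g :: "real \<Rightarrow> real"
  assumes "continuous_on J g" "is_interval J"
  shows "g ` J \<in> sets borel"
  using assms by (meson real_interval_borel_measurable is_interval_connected_1 connected_continuous_image)

text \<open>This form serves both measurability in \<open>y\<close> and integration: for continuous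
  \<open>g\<close> each term is the indicator of the image of an interval, hence of an
  interval.\<close>

lemma dyadic_crossings_eq_sum:
  "of_nat (dyadic_crossings g {a..b} n y) =
     (\<Sum>k\<in>{\<lfloor>2^n * a\<rfloor>..\<lfloor>2^n * b\<rfloor>}. indicator (g ` {t \<in> {a..b}. \<lfloor>2^n * t\<rfloor> = k}) y :: ennreal)"
proof -
  have "(\<lambda>t. \<lfloor>2^n * t\<rfloor>) ` {t \<in> {a..b}. g t = y} =
      {k \<in> {\<lfloor>2^n * a\<rfloor>..\<lfloor>2^n * b\<rfloor>}. y \<in> g ` {t \<in> {a..b}. \<lfloor>2^n * t\<rfloor> = k}}"
    by (auto intro!: floor_mono mult_left_mono)
  then show ?thesis
    unfolding dyadic_crossings_def by (simp add: indicator_def sum.If_cases Int_def)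
qed

text \<open>There are at most \<open>2^n * (b - a) + 2\<close> cells, each with an image of measure
  at most \<open>2 * L / 2^n\<close>. The powers of two cancel, so the bound is uniform in
  \<open>n\<close>.\<close>

lemma nn_integral_dyadic_crossings_le:
  assumes L: "L-lipschitz_on {a..b} g" and "a \<le> b"
  shows "(\<integral>\<^sup>+y. of_nat (dyadic_crossings g {a..b} n y) \<partial>lborel) \<le> ennreal (2 * L * (b - a + 2))"
proof -
  have L0: "L \<ge> 0" using L by (rule lipschitz_on_nonneg)
  define D where "D k = {t \<in> {a..b}. \<lfloor>2^n * t\<rfloor> = k}" for k
  have [measurable]: "g ` D k \<in> sets borel" for k
    unfolding D_def by (intro continuous_image_interval_borel is_interval_floor_preimage
        continuous_on_subset[OF lipschitz_on_continuous_on[OF L]]) auto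
  have m: "emeasure lborel (g ` D k) \<le> ennreal (2 * L / 2^n)" for k
  proof (cases "D k = {}")
    case False
    then obtain s where s: "s \<in> D k" by blast
    have "g ` D k \<subseteq> {g s - L / 2^n .. g s + L / 2^n}"
    proof clarify
      fix t assume t: "t \<in> D k"
      have "dist (g t) (g s) \<le> L * dist t s"
        using s t by (intro lipschitz_onD[OF L]) (auto simp: D_def)
      also have "dist t s \<le> 1 / 2^n"
      proof -
        have "\<bar>2^n * t - 2^n * s\<bar> < 1"
          using s t by (auto simp: D_def floor_eq_iff)
        then have "2^n * \<bar>t - s\<bar> < 1"
          by (simp add: abs_mult flip: right_diff_distrib)
        then show ?thesis by (simp add: dist_real_def field_simps)
      qed
      finally show "g t \<in> {g s - L / 2^n .. g s + L / 2^n}"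
        using L0 by (simp add: dist_real_def abs_diff_le_iff mult_left_mono)
    qed
    then have "emeasure lborel (g ` D k) \<le> emeasure lborel {g s - L / 2^n .. g s + L / 2^n}"
      by (intro emeasure_mono) auto
    also have "\<dots> = ennreal (2 * L / 2^n)"
      using L0 by simp
    finally show ?thesis .
  qed simp
  have "(\<integral>\<^sup>+y. of_nat (dyadic_crossings g {a..b} n y) \<partial>lborel) =
      (\<Sum>k\<in>{\<lfloor>2^n * a\<rfloor>..\<lfloor>2^n * b\<rfloor>}. emeasure lborel (g ` D k))"
    unfolding dyadic_crossings_eq_sum D_def[symmetric] by (subst nn_integral_sum) auto
  also have "\<dots> \<le> (\<Sum>k\<in>{\<lfloor>2^n * a\<rfloor>..\<lfloor>2^n * b\<rfloor>}. ennreal (2 * L / 2^n))"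
    by (intro sum_mono m)
  also have "\<dots> = ennreal (real (nat (\<lfloor>2^n * b\<rfloor> - \<lfloor>2^n * a\<rfloor> + 1)) * (2 * L / 2^n))"
    using L0 by (simp only: sum_constant card_atLeastAtMost_int ennreal_of_nat_eq_real_of_nat)
      (simp add: ennreal_mult[symmetric])
  also have "\<dots> \<le> ennreal (2 * L * (b - a + 2))"
  proof (rule ennreal_leI)
    have "\<lfloor>2^n * a\<rfloor> \<le> \<lfloor>2^n * b\<rfloor>" using \<open>a \<le> b\<close> by (intro floor_mono mult_left_mono) auto
    then have "real (nat (\<lfloor>2^n * b\<rfloor> - \<lfloor>2^n * a\<rfloor> + 1)) = of_int \<lfloor>2^n * b\<rfloor> + 1 - of_int \<lfloor>2^n * a\<rfloor>"
      by simp
    also have "\<dots> \<le> 2^n * b - 2^n * a + 2" by linarith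
    also have "\<dots> \<le> 2^n * (b - a + 2)"
      using one_le_power[of "2::real" n] by (simp add: algebra_simps)
    finally have "real (nat (\<lfloor>2^n * b\<rfloor> - \<lfloor>2^n * a\<rfloor> + 1)) * (2 * L / 2^n) \<le> 2^n * (b - a + 2) * (2 * L / 2^n)"
      using L0 by (intro mult_right_mono) auto
    then show "real (nat (\<lfloor>2^n * b\<rfloor> - \<lfloor>2^n * a\<rfloor> + 1)) * (2 * L / 2^n) \<le> 2 * L * (b - a + 2)"
      by (simp add: mult_ac)
  qed
  finally show ?thesis .
qed

text \<open>Choose one solution of \<open>g t = y\<close> in each \<open>J k\<close>. Finitely many
  distinct points have a positive minimal distance, and dyadic cells shorter than it tell them
  apart.\<close>

lemma card_hitting_le_dyadic_crossings:
  fixes J :: "'i \<Rightarrow> real set"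
  assumes "finite K" and dis: "disjoint_family_on J K" and "\<And>k. k \<in> K \<Longrightarrow> J k \<subseteq> {a..b}"
    and "\<And>k. k \<in> K \<Longrightarrow> y \<in> g ` J k"
  shows "\<exists>n. card K \<le> dyadic_crossings g {a..b} n y"
proof -
  have "\<forall>k\<in>K. \<exists>t. t \<in> J k \<and> g t = y" using assms(4) by blast
  then obtain \<tau> where \<tau>: "\<And>k. k \<in> K \<Longrightarrow> \<tau> k \<in> J k" "\<And>k. k \<in> K \<Longrightarrow> g (\<tau> k) = y" by metis
  have inj: "inj_on \<tau> K"
    using \<tau>(1) dis by (force simp: inj_on_def disjoint_family_on_def)
  have "\<exists>d>0. \<forall>s\<in>\<tau> ` K. \<forall>t\<in>\<tau> ` K. s \<noteq> t \<longrightarrow> d \<le> \<bar>s - t\<bar>"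
  proof -
    \<comment> \<open>The element 1 keeps \<open>Q\<close> nonempty when there is no pair of
      distinct points.\<close>
    define Q where "Q = insert 1 ((\<lambda>(s,t). \<bar>s - t\<bar>) ` {(s,t) \<in> \<tau> ` K \<times> \<tau> ` K. s \<noteq> t})"
    have fin: "finite Q"
      unfolding Q_def using \<open>finite K\<close>
      by (intro finite.insertI finite_imageI) (auto intro: finite_subset[of _ "\<tau> ` K \<times> \<tau> ` K"])
    have "Q \<noteq> {}" "\<forall>q\<in>Q. 0 < q"
      by (auto simp: Q_def)
    then have "Min Q > 0" using fin by (simp add: Min_gr_iff)
    moreover have "Min Q \<le> \<bar>s - t\<bar>" if "s \<in> \<tau> ` K" "t \<in> \<tau> ` K" "s \<noteq> t" for s t
      using that fin by (intro Min_le) (auto simp: Q_def)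
    ultimately show ?thesis by blast
  qed
  then obtain d where d: "d > 0" "\<And>s t. s \<in> \<tau> ` K \<Longrightarrow> t \<in> \<tau> ` K \<Longrightarrow> s \<noteq> t \<Longrightarrow> d \<le> \<bar>s - t\<bar>" by blast
  obtain n where n: "(1/2)^n < d"
    using real_arch_pow_inv[of d "1/2"] d(1) by auto
  have "inj_on (\<lambda>t. \<lfloor>2^n * t\<rfloor>) (\<tau> ` K)"
  proof (rule inj_onI, rule ccontr)
    fix s t assume st: "s \<in> \<tau> ` K" "t \<in> \<tau> ` K" "\<lfloor>2^n * s\<rfloor> = \<lfloor>2^n * t\<rfloor>" "s \<noteq> t"
    have "\<bar>2^n * s - 2^n * t\<bar> < 1" using st(3) by linarith
    then have "2^n * \<bar>s - t\<bar> < 1" by (simp add: abs_mult flip: right_diff_distrib)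
    moreover have "2^n * (1/2)^n < 2^n * \<bar>s - t\<bar>"
      using n d(2)[OF st(1,2,4)] by (intro mult_strict_left_mono) auto
    ultimately show False by (simp add: power_one_over)
  qed
  then have "card K = card ((\<lambda>t. \<lfloor>2^n * t\<rfloor>) ` \<tau> ` K)"
    using inj by (simp add: card_image)
  also have "\<dots> \<le> dyadic_crossings g {a..b} n y"
    unfolding dyadic_crossings_def using assms(3) \<tau>
    by (intro card_mono finite_floor_image image_mono) blast
  finally show ?thesis by blast
qed

text \<open>The image is an interval and contains the segment between any two of its points, so its
  length bounds their distance.\<close>

lemma diameter_image_le_emeasure:
  fixes g :: "real \<Rightarrow> real"
  assumes "is_interval J" "continuous_on J g" "bounded (g ` J)"
  shows "ennreal (diameter (g ` J)) \<le> emeasure lborel (g ` J)"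
proof -
  have conn: "is_interval (g ` J)"
    using assms by (meson is_interval_connected_1 connected_continuous_image)
  have borel: "g ` J \<in> sets borel"
    using conn by (rule real_interval_borel_measurable)
  have fin: "emeasure lborel (g ` J) < \<infinity>"
    using assms(3) by (rule emeasure_bounded_finite)
  have "norm (x - y) \<le> measure lborel (g ` J)" if "x \<in> g ` J" "y \<in> g ` J" for x y
  proof -
    have "{min x y..max x y} \<subseteq> g ` J"
      using conn that unfolding is_interval_1 by (auto simp: min_def max_def split: if_splits)
    then have "emeasure lborel {min x y..max x y} \<le> emeasure lborel (g ` J)"
      using borel by (intro emeasure_mono) auto
    then have "ennreal \<bar>x - y\<bar> \<le> ennreal (measure lborel (g ` J))"
      using fin by (subst (asm) emeasure_lborel_Icc) (auto simp: emeasure_eq_ennreal_measure top.not_eq_extremum abs_if min_def max_def split: if_splits)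
    then show ?thesis by simp
  qed
  then have "diameter (g ` J) \<le> measure lborel (g ` J)"
    by (intro diameter_le) auto
  then show ?thesis
    using fin by (simp add: emeasure_eq_ennreal_measure ennreal_leI top.not_eq_extremum)
qed

text \<open>The Banach indicatrix \<open>N\<close> of \<open>g\<close> is integrable. The finite measure with density \<open>N\<close> therefore
  gives small mass to some open \<open>G \<supseteq> Z\<close>, and this mass bounds the total oscillation of \<open>g\<close> over
  disjoint intervals on which \<open>g\<close> takes its values in \<open>G\<close>.\<close>

lemma lipschitz_small_variation_near_null_values:
  fixes g :: "real \<Rightarrow> real"
  assumes L: "L-lipschitz_on {a..b} g" and "a \<le> b" and "negligible Z" and "e > 0"
  obtains G where "open G" "Z \<subseteq> G"
    "\<And>J :: nat \<Rightarrow> real set. \<lbrakk>disjoint_family J; \<And>k. is_interval (J k); \<And>k. J k \<subseteq> {a..b};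
        \<And>k. g ` J k \<subseteq> G\<rbrakk> \<Longrightarrow> (\<Sum>k. ennreal (diameter (g ` J k))) \<le> ennreal e"
proof -
  define c where "c n y = (of_nat (dyadic_crossings g {a..b} n y) :: ennreal)" for n y
  define N where "N y = (SUP n. c n y)" for y
  have cont: "continuous_on J g" if "J \<subseteq> {a..b}" for J
    using lipschitz_on_continuous_on[OF L] that by (rule continuous_on_subset)
  have c_meas [measurable]: "c n \<in> borel_measurable borel" for n
  proof -
    have [measurable]: "g ` {t \<in> {a..b}. \<lfloor>2^n * t\<rfloor> = k} \<in> sets borel" for k
      by (intro continuous_image_interval_borel is_interval_floor_preimage cont) auto
    show ?thesis
      unfolding c_def dyadic_crossings_eq_sum by measurable
  qed
  have [measurable]: "N \<in> borel_measurable borel"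
    unfolding N_def by (intro borel_measurable_SUP c_meas) auto
  have "(\<integral>\<^sup>+y. N y \<partial>lborel) = (SUP n. \<integral>\<^sup>+y. c n y \<partial>lborel)"
    unfolding N_def
  proof (rule nn_integral_monotone_convergence_SUP)
    show "incseq c"
      by (intro incseq_SucI le_funI) (simp add: c_def dyadic_crossings_mono)
  qed simp
  also have "\<dots> \<le> ennreal (2 * L * (b - a + 2))"
    unfolding c_def by (intro SUP_least nn_integral_dyadic_crossings_le L \<open>a \<le> b\<close>)
  finally have N_fin: "(\<integral>\<^sup>+y. N y \<partial>lborel) < \<infinity>"
    by (rule le_less_trans) simp
  define \<nu> where "\<nu> = density lborel N"
  have \<nu>: "emeasure \<nu> A = (\<integral>\<^sup>+y. N y * indicator A y \<partial>lborel)" if "A \<in> sets borel" for A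
    unfolding \<nu>_def using that by (intro emeasure_density) auto
  \<comment> \<open>\<open>Z\<close> itself may fail to be Borel; a Borel null set containing it
    replaces it.\<close>
  obtain Z' where Z': "Z \<subseteq> Z'" "Z' \<in> null_sets lborel"
    using \<open>negligible Z\<close> by (auto simp: negligible_iff_null_sets null_sets_completion_iff2)
  have "Z' \<in> null_sets \<nu>"
    unfolding \<nu>_def using Z'(2) by (subst null_sets_density_iff) (auto intro: AE_mp[OF AE_not_in])
  then have "emeasure \<nu> Z' = 0" by auto
  \<comment> \<open>Integrability of \<open>N\<close> makes \<open>\<nu>\<close> a finite Borel
    measure, hence outer regular, so the null set \<open>Z'\<close> has open neighbourhoods of small
    mass.\<close>
  have "emeasure \<nu> (space \<nu>) \<noteq> \<infinity>"
    using N_fin \<nu>[of UNIV] by (simp add: \<nu>_def)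
  then have "emeasure \<nu> Z' = (INF U \<in> {U. Z' \<subseteq> U \<and> open U}. emeasure \<nu> U)"
    using Z'(2) by (intro outer_regular) (auto simp: \<nu>_def null_sets_def)
  then have "(INF U \<in> {U. Z' \<subseteq> U \<and> open U}. emeasure \<nu> U) < ennreal e"
    using \<open>emeasure \<nu> Z' = 0\<close> \<open>e > 0\<close> by simp
  then obtain G where G: "Z' \<subseteq> G" "open G" "emeasure \<nu> G < ennreal e"
    unfolding INF_less_iff by blast
  show ?thesis
  proof
    show "open G" by fact
    show "Z \<subseteq> G" using Z' G by blast
    fix J :: "nat \<Rightarrow> real set"
    assume J: "disjoint_family J" "\<And>k. is_interval (J k)" "\<And>k. J k \<subseteq> {a..b}" "\<And>k. g ` J k \<subseteq> G"
    have [measurable]: "g ` J k \<in> sets borel" for k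
      by (intro continuous_image_interval_borel J cont)
    have "bounded (g ` J k)" for k
      using compact_imp_bounded[OF compact_continuous_image[OF cont[OF order_refl] compact_Icc]]
      by (rule bounded_subset) (use J(3) in blast)
    then have "(\<Sum>k. ennreal (diameter (g ` J k))) \<le> (\<Sum>k. emeasure lborel (g ` J k))"
      by (intro suminf_le diameter_image_le_emeasure J cont) auto
    also have "\<dots> = (\<integral>\<^sup>+y. (\<Sum>k. indicator (g ` J k) y) \<partial>lborel)"
      by (subst nn_integral_suminf) auto
    also have "\<dots> \<le> (\<integral>\<^sup>+y. N y * indicator G y \<partial>lborel)"
    proof (rule nn_integral_mono)
      fix y :: real
      show "(\<Sum>k. indicator (g ` J k) y) \<le> N y * indicator G y"
      proof (cases "y \<in> G")
        case True
        have "(\<Sum>k<m. indicator (g ` J k) y) \<le> N y" for m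
        proof -
          \<comment> \<open>Disjoint intervals that hit \<open>y\<close> contain different solutions
            of \<open>g t = y\<close>, so their number is at most the indicatrix at
            \<open>y\<close>.\<close>
          define K where "K = {k\<in>{..<m}. y \<in> g ` J k}"
          have "\<exists>n. card K \<le> dyadic_crossings g {a..b} n y"
            using J(1,3) by (intro card_hitting_le_dyadic_crossings[of K J])
              (auto simp: K_def disjoint_family_on_def)
          then obtain n where "card K \<le> dyadic_crossings g {a..b} n y" ..
          have "(\<Sum>k<m. indicator (g ` J k) y) = (of_nat (card K) :: ennreal)"
            by (simp add: K_def indicator_def sum.If_cases Int_def)
          also have "\<dots> \<le> c n y"
            unfolding c_def using \<open>card K \<le> _\<close> by simp
          also have "\<dots> \<le> N y"
            unfolding N_def by (rule SUP_upper) simp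
          finally show ?thesis .
        qed
        then show ?thesis
          using True by (simp add: suminf_eq_SUP SUP_least)
      next
        case False
        then have "indicator (g ` J k) y = (0::ennreal)" for k
          using J(4) by (auto simp: indicator_def)
        then show ?thesis by simp
      qed
    qed
    also have "\<dots> = emeasure \<nu> G"
      using \<open>open G\<close> by (intro \<nu>[symmetric]) auto
    also have "\<dots> \<le> ennreal e"
      using G(3) by simp
    finally show "(\<Sum>k. ennreal (diameter (g ` J k))) \<le> ennreal e" .
  qed
qed

section \<open>Lipschitz curves with null coordinate projections\<close>

lemma countable_disjoint_sets_enumeration:
  assumes "countable \<C>" "pairwise disjnt \<C>"
  obtains J :: "nat \<Rightarrow> 'a set" where "disjoint_family J" "range J \<subseteq> insert {} \<C>" "\<Union>\<C> \<subseteq> (\<Union>k. J k)"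
proof
  \<comment> \<open>Indices that encode no member of the family get the empty set, which keeps the
    sequence disjoint.\<close>
  define J where "J k = (if k \<in> to_nat_on \<C> ` \<C> then from_nat_into \<C> k else {})" for k
  show "disjoint_family J"
    using assms(1) pairwiseD[OF assms(2)] by (fastforce simp: disjoint_family_on_def J_def disjnt_def)
  show "range J \<subseteq> insert {} \<C>"
    using assms(1) by (auto simp: J_def)
  show "\<Union>\<C> \<subseteq> (\<Union>k. J k)"
  proof
    fix x assume "x \<in> \<Union>\<C>"
    then obtain C where "C \<in> \<C>" "x \<in> C" by blast
    then have "x \<in> J (to_nat_on \<C> C)" using assms(1) by (simp add: J_def)
    then show "x \<in> (\<Union>k. J k)" by blast
  qed
qed

text \<open>The intervals are the connected components, countably many because they are open and
  disjoint.\<close>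

lemma open_real_disjoint_intervals:
  fixes W :: "real set"
  assumes "open W"
  obtains J :: "nat \<Rightarrow> real set" where "disjoint_family J" "\<And>k. is_interval (J k)" "W = (\<Union>k. J k)"
proof -
  have dis: "pairwise disjnt (components W)"
    using pairwise_disjoint_components[of W] by (simp add: pairwise_def disjnt_def)
  then have "countable (components W)"
    by (rule countable_disjoint_open_subsets[rotated]) (rule open_components[OF \<open>open W\<close>])
  then obtain J :: "nat \<Rightarrow> real set" where J: "disjoint_family J" "range J \<subseteq> insert {} (components W)" "\<Union>(components W) \<subseteq> (\<Union>k. J k)"
    using countable_disjoint_sets_enumeration[OF _ dis] by metis
  have Jk: "is_interval (J k)" "J k \<subseteq> W" for k
  proof -
    have "J k = {} \<or> J k \<in> components W" using J(2) by blast
    then show "is_interval (J k)" "J k \<subseteq> W"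
      by (auto simp: is_interval_connected_1 dest: in_components_connected in_components_subset)
  qed
  moreover have "W = (\<Union>k. J k)"
    using J(3) UN_least[of UNIV J W] Jk(2) by simp
  ultimately show ?thesis
    using that J(1) by blast
qed

text \<open>Each coordinate has an open set \<open>G i\<close> around its values on \<open>A\<close>
  over which it oscillates little. The parameters at which all coordinates lie in their
  \<open>G i\<close> form a relatively open set containing \<open>A\<close>. Its interval pieces map
  to a cover, and the diameter of each image is at most the sum of its coordinate
  oscillations.\<close>

lemma hausdorff1_lipschitz_curve_null:
  fixes f :: "real \<Rightarrow> 'a::euclidean_space"
  assumes L: "L-lipschitz_on {a..b} f" and A: "A \<subseteq> {a..b}"
    and null: "\<And>i. i \<in> Basis \<Longrightarrow> negligible ((\<lambda>t. f t \<bullet> i) ` A)"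
  shows "hausdorff1 (f ` A) = 0"
proof (cases "A = {}")
  case True
  then show ?thesis
    by (auto simp: hausdorff1_eq_0_iff intro!: exI[of _ "\<lambda>_. {}"])
next
  case False
  then have "a \<le> b" using A by auto
  show ?thesis
    unfolding hausdorff1_eq_0_iff
  proof (intro allI impI)
    fix e :: real assume "e > 0"
    define e' where "e' = e / DIM('a)"
    have "e' > 0" using \<open>e > 0\<close> by (simp add: e'_def)
    have Li: "L-lipschitz_on {a..b} (\<lambda>t. f t \<bullet> i)" if "i \<in> Basis" for i
    proof (rule lipschitz_onI)
      fix s t assume st: "s \<in> {a..b}" "t \<in> {a..b}"
      have "dist (f s \<bullet> i) (f t \<bullet> i) \<le> dist (f s) (f t)"
        using Basis_le_norm[OF that, of "f s - f t"] by (simp add: dist_norm inner_diff_left)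
      also have "\<dots> \<le> L * dist s t"
        using L st by (rule lipschitz_onD)
      finally show "dist (f s \<bullet> i) (f t \<bullet> i) \<le> L * dist s t" .
    qed (rule lipschitz_on_nonneg[OF L])
    \<comment> \<open>This records the conclusion about interval families as a predicate, so that a
      \<open>G i\<close> can be chosen for all coordinates at once.\<close>
    define good where "good i G \<longleftrightarrow> (\<forall>J :: nat \<Rightarrow> real set. disjoint_family J \<longrightarrow> (\<forall>k. is_interval (J k)) \<longrightarrow>
        (\<forall>k. J k \<subseteq> {a..b}) \<longrightarrow> (\<forall>k. (\<lambda>t. f t \<bullet> i) ` J k \<subseteq> G) \<longrightarrow>
        (\<Sum>k. ennreal (diameter ((\<lambda>t. f t \<bullet> i) ` J k))) \<le> ennreal e')" for i G
    have "\<exists>G. open G \<and> (\<lambda>t. f t \<bullet> i) ` A \<subseteq> G \<and> good i G" if i: "i \<in> Basis" for i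
      by (rule lipschitz_small_variation_near_null_values[OF Li[OF i] \<open>a \<le> b\<close> null[OF i] \<open>e' > 0\<close>])
        (unfold good_def, blast)
    then obtain G where G: "\<And>i. i \<in> Basis \<Longrightarrow> open (G i)" "\<And>i. i \<in> Basis \<Longrightarrow> (\<lambda>t. f t \<bullet> i) ` A \<subseteq> G i"
      "\<And>i. i \<in> Basis \<Longrightarrow> good i (G i)"
      by metis
    have "open {x. \<forall>i\<in>Basis. x \<bullet> i \<in> G i}"
    proof -
      have "{x. \<forall>i\<in>Basis. x \<bullet> i \<in> G i} = (\<Inter>i\<in>Basis. (\<lambda>x. x \<bullet> i) -` G i)" by auto
      then show ?thesis
        by (simp only:) (intro open_INT finite_Basis ballI open_vimage G(1) continuous_intros)
    qed
    then have "\<exists>W. open W \<and> W \<inter> {a..b} = f -` {x. \<forall>i\<in>Basis. x \<bullet> i \<in> G i} \<inter> {a..b}"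
      by (rule lipschitz_on_continuous_on[OF L, unfolded continuous_on_open_invariant, rule_format])
    then obtain W where W: "open W" "W \<inter> {a..b} = f -` {x. \<forall>i\<in>Basis. x \<bullet> i \<in> G i} \<inter> {a..b}"
      by (elim exE conjE)
    obtain J0 :: "nat \<Rightarrow> real set" where J0: "disjoint_family J0" "\<And>k. is_interval (J0 k)" "W = (\<Union>k. J0 k)"
      using open_real_disjoint_intervals[OF W(1)] by metis
    \<comment> \<open>Cutting with \<open>{a..b}\<close> keeps the pieces disjoint intervals and
      leaves only parameters at which every coordinate lies in its \<open>G i\<close>.\<close>
    define J where "J k = J0 k \<inter> {a..b}" for k
    have J: "disjoint_family J" "\<And>k. is_interval (J k)" "\<And>k. J k \<subseteq> {a..b}" "(\<Union>k. J k) = W \<inter> {a..b}"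
      using J0 by (auto simp: J_def disjoint_family_on_def is_interval_Int is_interval_cc)
    have "A \<subseteq> (\<Union>k. J k)"
    proof
      fix t assume "t \<in> A"
      then have "t \<in> f -` {x. \<forall>i\<in>Basis. x \<bullet> i \<in> G i} \<inter> {a..b}"
        using G(2) A by auto
      then show "t \<in> (\<Union>k. J k)"
        unfolding J(4) W(2) .
    qed
    then have "f ` A \<subseteq> (\<Union>k. f ` J k)" by blast
    have f_bdd: "bounded (f ` {a..b})"
      using lipschitz_on_continuous_on[OF L] by (intro compact_imp_bounded compact_continuous_image) auto
    then have bdd: "bounded (f ` J k)" for k
      by (rule bounded_subset) (use J(3) in blast)
    have bddi: "bounded ((\<lambda>t. f t \<bullet> i) ` J k)" for i k
      using bounded_linear_image[OF bdd bounded_linear_inner_left, of i k] by (simp add: image_image)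
    have "ennreal (diameter (f ` J k)) \<le> (\<Sum>i\<in>Basis. ennreal (diameter ((\<lambda>t. f t \<bullet> i) ` J k)))" for k
    proof -
      have "diameter (f ` J k) \<le> (\<Sum>i\<in>Basis. diameter ((\<lambda>t. f t \<bullet> i) ` J k))"
      proof (rule diameter_le)
        fix x y assume "x \<in> f ` J k" "y \<in> f ` J k"
        then obtain s t where st: "s \<in> J k" "t \<in> J k" "x = f s" "y = f t" by blast
        have "norm (x - y) \<le> (\<Sum>i\<in>Basis. \<bar>(x - y) \<bullet> i\<bar>)" by (rule norm_le_l1)
        also have "\<dots> \<le> (\<Sum>i\<in>Basis. diameter ((\<lambda>t. f t \<bullet> i) ` J k))"
        proof (rule sum_mono)
          fix i :: 'a
          show "\<bar>(x - y) \<bullet> i\<bar> \<le> diameter ((\<lambda>t. f t \<bullet> i) ` J k)"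
            using diameter_bounded_bound[OF bddi, of "f s \<bullet> i" i k "f t \<bullet> i"] st
            by (auto simp: dist_real_def inner_diff_left)
        qed
        finally show "norm (x - y) \<le> \<dots>" .
      qed (simp add: sum_nonneg diameter_ge_0 bddi)
      then show ?thesis
        by (simp add: sum_ennreal diameter_ge_0 bddi ennreal_leI)
    qed
    then have "(\<Sum>k. ennreal (diameter (f ` J k))) \<le> (\<Sum>k. \<Sum>i\<in>Basis. ennreal (diameter ((\<lambda>t. f t \<bullet> i) ` J k)))"
      by (intro suminf_le) auto
    also have "\<dots> = (\<Sum>i\<in>Basis. \<Sum>k. ennreal (diameter ((\<lambda>t. f t \<bullet> i) ` J k)))"
      by (rule suminf_sum) auto
    also have "\<dots> \<le> (\<Sum>i\<in>(Basis::'a set). ennreal e')"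
    proof (rule sum_mono)
      fix i :: 'a assume i: "i \<in> Basis"
      have "(\<lambda>t. f t \<bullet> i) ` J k \<subseteq> G i" for k
        using J(4) W(2) i by blast
      then show "(\<Sum>k. ennreal (diameter ((\<lambda>t. f t \<bullet> i) ` J k))) \<le> ennreal e'"
        using G(3)[OF i] J(1-3) unfolding good_def by blast
    qed
    also have "\<dots> = ennreal e"
      using \<open>e > 0\<close> by (simp add: e'_def ennreal_of_nat_eq_real_of_nat ennreal_mult[symmetric])
    finally show "\<exists>U::nat \<Rightarrow> _. f ` A \<subseteq> (\<Union>i. U i) \<and> (\<forall>i. bounded (U i)) \<and>
        (\<Sum>i. ennreal (diameter (U i))) \<le> ennreal e"
      using \<open>f ` A \<subseteq> _\<close> bdd by (intro exI[of _ "\<lambda>k. f ` J k"]) blast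
  qed
qed

section \<open>Regular level sets of continuously differentiable functions\<close>

text \<open>In finite dimension, continuity of the derivative in operator norm can be tested on the
  basis vectors.\<close>

lemma C1_onI:
  fixes f :: "'a::euclidean_space \<Rightarrow> 'b::real_normed_vector"
  assumes der: "\<And>x. x \<in> S \<Longrightarrow> (f has_derivative f' x) (at x)"
    and cont: "\<And>i. i \<in> Basis \<Longrightarrow> continuous_on S (\<lambda>x. f' x i)"
  shows "C1_on S f"
  unfolding C1_on_def
proof (intro exI conjI ballI)
  have app: "blinfun_apply (Blinfun (f' x)) = f' x" if "x \<in> S" for x
    using der[OF that] by (intro bounded_linear_Blinfun_apply has_derivative_bounded_linear)
  show "(f has_derivative blinfun_apply (Blinfun (f' x))) (at x)" if "x \<in> S" for x
    using der that by (simp add: app)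
  show "continuous_on S (\<lambda>x. Blinfun (f' x))"
  proof (rule continuous_on_blinfun_componentwise)
    fix i :: 'a assume "i \<in> Basis"
    then show "continuous_on S (\<lambda>x. blinfun_apply (Blinfun (f' x)) i)"
      using cont by (subst continuous_on_cong[OF refl, of _ _ "\<lambda>x. f' x i"]) (auto simp: app)
  qed
qed

lemma C1_on_Pair:
  fixes f :: "'a::euclidean_space \<Rightarrow> 'b::real_normed_vector" and g :: "'a \<Rightarrow> 'c::real_normed_vector"
  assumes "C1_on S f" "C1_on S g"
  shows "C1_on S (\<lambda>x. (f x, g x))"
proof -
  obtain f' where f': "\<And>x. x \<in> S \<Longrightarrow> (f has_derivative blinfun_apply (f' x)) (at x)" "continuous_on S f'"
    using assms(1) unfolding C1_on_def by blast
  obtain g' where g': "\<And>x. x \<in> S \<Longrightarrow> (g has_derivative blinfun_apply (g' x)) (at x)" "continuous_on S g'"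
    using assms(2) unfolding C1_on_def by blast
  show ?thesis
  proof (rule C1_onI)
    show "((\<lambda>x. (f x, g x)) has_derivative (\<lambda>v. (f' x v, g' x v))) (at x)" if "x \<in> S" for x
      using that by (intro has_derivative_Pair f' g')
    show "continuous_on S (\<lambda>x. (f' x v, g' x v))" for v
      by (intro continuous_intros f' g')
  qed
qed

text \<open>Meant for \<open>f\<close> the inverse of a chart, which carries straight segments back
  to curves in the submanifold.\<close>

lemma C1_on_compose_line:
  fixes f :: "'a::real_normed_vector \<Rightarrow> 'b::real_normed_vector"
  assumes "C1_on V f" and "\<And>t. t \<in> I \<Longrightarrow> y + t *\<^sub>R v \<in> V"
  shows "C1_on I (\<lambda>t::real. f (y + t *\<^sub>R v))"
proof -
  obtain f' where f': "\<And>x. x \<in> V \<Longrightarrow> (f has_derivative blinfun_apply (f' x)) (at x)" "continuous_on V f'"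
    using assms(1) unfolding C1_on_def by blast
  show ?thesis
  proof (rule C1_onI)
    fix t assume t: "t \<in> I"
    have "((\<lambda>t. y + t *\<^sub>R v) has_derivative (\<lambda>s. s *\<^sub>R v)) (at t)"
      by (auto intro!: derivative_eq_intros)
    then show "((\<lambda>t. f (y + t *\<^sub>R v)) has_derivative (\<lambda>s. f' (y + t *\<^sub>R v) (s *\<^sub>R v))) (at t)"
      by (rule has_derivative_compose[where f = "\<lambda>t. y + t *\<^sub>R v" and g = f, OF _ f'(1)[OF assms(2)[OF t]]])
  next
    fix s :: real
    have "continuous_on I (\<lambda>t. f' (y + t *\<^sub>R v))"
      using assms(2) by (intro continuous_on_compose2[OF f'(2)] continuous_intros) auto
    then show "continuous_on I (\<lambda>t. f' (y + t *\<^sub>R v) (s *\<^sub>R v))"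
      by (intro continuous_intros)
  qed
qed

text \<open>The chart replaces the component of \<open>x\<close> along \<open>G p\<close> by a multiple of \<open>h x\<close>, scaled so that its
  derivative at \<open>p\<close> is the identity.\<close>

lemma regular_level_set_chart:
  fixes h :: "'a::euclidean_space \<Rightarrow> real"
  assumes der: "\<And>x. (h has_derivative (\<lambda>v. G x \<bullet> v)) (at x)" and cont: "continuous_on UNIV G"
    and Gp: "G p \<noteq> 0"
  obtains U V \<psi> \<psi>' where "open U" "p \<in> U" "open V" "homeomorphism U V \<psi> \<psi>'"
    "C1_on U \<psi>" "C1_on V \<psi>'" "\<psi> ` ({x. h x = 0} \<inter> U) = V \<inter> {y. G p \<bullet> y = 0}"
    "(\<psi>' has_derivative (\<lambda>v. v)) (at (\<psi> p))"
proof -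
  define n where "n = G p"
  have n: "n \<bullet> n \<noteq> 0" using Gp by (simp add: n_def)
  define c where "c = 1 / (n \<bullet> n)"
  define \<psi> where "\<psi> x = x + (c * (h x - n \<bullet> x)) *\<^sub>R n" for x
  define E where "E x v = v + (c * (G x \<bullet> v - n \<bullet> v)) *\<^sub>R n" for x v
  have "linear (E x)" for x
    by (rule linearI) (simp_all add: E_def algebra_simps inner_add_right)
  then have E: "blinfun_apply (Blinfun (E x)) = E x" for x
    by (intro bounded_linear_Blinfun_apply linear_conv_bounded_linear[THEN iffD1])
  have der\<psi>: "(\<psi> has_derivative E x) (at x)" for x
    unfolding \<psi>_def[abs_def] E_def[abs_def]
    by (intro has_derivative_add has_derivative_scaleR_left has_derivative_mult_right has_derivative_diff
        has_derivative_inner_right has_derivative_ident der)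
  have contE: "continuous_on S (\<lambda>x. E x v)" for S v
    unfolding E_def by (intro continuous_intros continuous_on_subset[OF cont]) auto
  \<comment> \<open>\<open>E x\<close> is a rank-one perturbation of the identity with determinant
    \<open>c * (G x \<bullet> n)\<close>, so \<open>U0\<close> is the set where it is
    invertible.\<close>
  define U0 where "U0 = {x. G x \<bullet> n \<noteq> 0}"
  have "open U0"
    unfolding U0_def by (intro open_Collect_neq continuous_intros cont)
  have "p \<in> U0" using n by (simp add: U0_def n_def)
  \<comment> \<open>At \<open>p\<close> the correction term vanishes, so the left inverse demanded
    by the inverse function theorem is the identity.\<close>
  have "Blinfun (E p) = id_blinfun"
    by (rule blinfun_eqI) (simp add: E, simp add: E_def n_def)
  then have id: "id_blinfun o\<^sub>L Blinfun (E p) = id_blinfun"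
    by (intro blinfun_eqI) simp
  have der': "(\<psi> has_derivative blinfun_apply (Blinfun (E x))) (at x)" for x
    by (simp add: E der\<psi>)
  have cont': "continuous_on U0 (\<lambda>x. Blinfun (E x))"
    by (intro continuous_on_blinfun_componentwise) (simp add: E contE)
  obtain U V g g' where U: "open U" "U \<subseteq> U0" "p \<in> U" and V: "open V" "\<psi> p \<in> V" and hom: "homeomorphism U V \<psi> g"
    and derg: "\<And>y. y \<in> V \<Longrightarrow> (g has_derivative g' y) (at y)"
    and g': "\<And>y. y \<in> V \<Longrightarrow> g' y = inv (blinfun_apply (Blinfun (E (g y))))"
    and bij: "\<And>y. y \<in> V \<Longrightarrow> bij (blinfun_apply (Blinfun (E (g y))))"
    by (rule inverse_function_theorem[OF \<open>open U0\<close> der' cont' \<open>p \<in> U0\<close> id]) blast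
  have gU: "g y \<in> U" if "y \<in> V" for y
    using hom that unfolding homeomorphism_def by blast
  \<comment> \<open>An explicit inverse of \<open>E x\<close> on \<open>U0\<close>; its continuous
    dependence on \<open>x\<close> gives the continuity of the derivative of
    \<open>g\<close>.\<close>
  define R where "R x w = w + ((n \<bullet> w - G x \<bullet> w) / (G x \<bullet> n)) *\<^sub>R n" for x w
  have g'R: "g' y = R (g y)" if y: "y \<in> V" for y
  proof
    fix w
    have ne: "G (g y) \<bullet> n \<noteq> 0" using gU[OF y] U(2) by (auto simp: U0_def)
    have "E (g y) (R (g y) w) = w"
    proof -
      define s where "s = (n \<bullet> w - G (g y) \<bullet> w) / (G (g y) \<bullet> n)"
      have "s * (G (g y) \<bullet> n) = n \<bullet> w - G (g y) \<bullet> w" using ne by (simp add: s_def)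
      then have "c * (G (g y) \<bullet> (w + s *\<^sub>R n) - n \<bullet> (w + s *\<^sub>R n)) = - s"
        using n by (simp add: c_def inner_add_right field_simps)
      then show ?thesis
        by (simp add: E_def R_def s_def)
    qed
    then show "g' y w = R (g y) w"
      using bij_is_inj[OF bij[OF y]] unfolding g'[OF y] E by (intro inv_f_eq)
  qed
  show ?thesis
  proof
    show "C1_on U \<psi>"
      using der\<psi> contE by (rule C1_onI)
    show "C1_on V g"
    proof (rule C1_onI[OF derg])
      fix w
      have "continuous_on V (\<lambda>y. R (g y) w)"
      proof -
        have "continuous_on V g" using hom by (simp add: homeomorphism_def)
        then have "continuous_on V (\<lambda>y. G (g y))"
          by (rule continuous_on_compose2[OF cont]) auto
        moreover have "\<forall>y\<in>V. G (g y) \<bullet> n \<noteq> 0"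
          using gU U(2) unfolding U0_def by blast
        ultimately show ?thesis
          unfolding R_def by (intro continuous_intros)
      qed
      then show "continuous_on V (\<lambda>y. g' y w)"
        by (subst continuous_on_cong[OF refl, of _ _ "\<lambda>y. R (g y) w"]) (auto simp: g'R)
    qed
    \<comment> \<open>The chart turns \<open>h\<close> into the linear form
      \<open>G p \<bullet> y\<close>, and so the level set into a piece of a hyperplane.\<close>
    have h: "G p \<bullet> \<psi> x = h x" for x
      using n by (simp add: \<psi>_def c_def n_def inner_add_right)
    have "\<psi> ` U = V" using hom by (simp add: homeomorphism_def)
    then show "\<psi> ` ({x. h x = 0} \<inter> U) = V \<inter> {y. G p \<bullet> y = 0}"
      using h by auto
    have "g (\<psi> p) = p" using hom U(3) by (simp add: homeomorphism_def)
    then have "g' (\<psi> p) = (\<lambda>v. v)"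
      using g'R[OF V(2)] by (simp add: R_def n_def fun_eq_iff)
    then show "(g has_derivative (\<lambda>v. v)) (at (\<psi> p))"
      using derg[OF V(2)] by simp
  qed fact+
qed

lemma C1_submanifold_level_set:
  fixes h :: "'a::euclidean_space \<Rightarrow> real"
  assumes der: "\<And>x. (h has_derivative (\<lambda>v. G x \<bullet> v)) (at x)" and cont: "continuous_on UNIV G"
    and reg: "\<And>x. h x = 0 \<Longrightarrow> G x \<noteq> 0"
  shows "C1_submanifold (DIM('a) - 1) {x. h x = 0}"
  unfolding C1_submanifold_def
proof
  fix p assume "p \<in> {x. h x = 0}"
  then have "G p \<noteq> 0" using reg by simp
  then have "subspace {y. G p \<bullet> y = 0}" "dim {y. G p \<bullet> y = 0} = DIM('a) - 1"
    by (simp_all add: subspace_hyperplane dim_hyperplane)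
  moreover obtain U V \<psi> \<psi>' where "open U" "p \<in> U" "open V" "homeomorphism U V \<psi> \<psi>'"
    "C1_on U \<psi>" "C1_on V \<psi>'" "\<psi> ` ({x. h x = 0} \<inter> U) = V \<inter> {y. G p \<bullet> y = 0}"
    by (rule regular_level_set_chart[OF der cont \<open>G p \<noteq> 0\<close>])
  ultimately show "\<exists>U V \<psi> \<psi>' S. open U \<and> p \<in> U \<and> open V \<and> homeomorphism U V \<psi> \<psi>' \<and> C1_on U \<psi> \<and>
      C1_on V (\<psi>' :: 'a \<Rightarrow> 'a) \<and> subspace S \<and> dim S = DIM('a) - 1 \<and> \<psi> ` ({x. h x = 0} \<inter> U) = V \<inter> S"
    by (intro exI[of _ U] exI[of _ V] exI[of _ \<psi>] exI[of _ \<psi>'] exI[of _ "{y. G p \<bullet> y = 0}"] conjI)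
qed

text \<open>Constancy of \<open>h\<close> along curves gives one inclusion. For the other, the line
  through \<open>\<psi> p\<close> in direction \<open>v\<close> stays in the hyperplane, and the
  inverse chart, whose derivative at \<open>\<psi> p\<close> is the identity, carries it to a curve
  with velocity \<open>v\<close>.\<close>

lemma tangent_space_level_set:
  fixes h :: "'a::euclidean_space \<Rightarrow> real"
  assumes der: "\<And>x. (h has_derivative (\<lambda>v. G x \<bullet> v)) (at x)" and cont: "continuous_on UNIV G"
    and p: "h p = 0" "G p \<noteq> 0"
  shows "tangent_space {x. h x = 0} p = {v. G p \<bullet> v = 0}"
proof (intro subset_antisym subsetI)
  fix v assume "v \<in> tangent_space {x. h x = 0} p"
  then obtain \<gamma> e where \<gamma>: "e > 0" "\<gamma> ` {-e<..<e} \<subseteq> {x. h x = 0}" "\<gamma> 0 = p"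
      "(\<gamma> has_vector_derivative v) (at (0::real))"
    unfolding tangent_space_def by blast
  have "((\<lambda>t. h (\<gamma> t)) has_derivative (\<lambda>s. G p \<bullet> (s *\<^sub>R v))) (at 0)"
    using has_derivative_compose[OF \<gamma>(4)[unfolded has_vector_derivative_def] der[of "\<gamma> 0"]]
    by (simp only: \<gamma>(3))
  then have "((\<lambda>t. h (\<gamma> t)) has_real_derivative (G p \<bullet> v)) (at 0)"
    by (rule has_derivative_imp_has_field_derivative) simp
  then have "G p \<bullet> v = 0"
  proof (rule DERIV_local_const[OF _ \<gamma>(1)])
    show "\<forall>y. \<bar>0 - y\<bar> < e \<longrightarrow> h (\<gamma> 0) = h (\<gamma> y)"
      using \<gamma>(1,2) by (auto simp: image_subset_iff abs_less_iff)
  qed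
  then show "v \<in> {v. G p \<bullet> v = 0}" by simp
next
  fix v assume "v \<in> {v. G p \<bullet> v = 0}"
  then have v: "G p \<bullet> v = 0" by simp
  obtain U V \<psi> g where U: "open U" "p \<in> U" and V: "open V" and hom: "homeomorphism U V \<psi> g"
    and C1: "C1_on V g" and img: "\<psi> ` ({x. h x = 0} \<inter> U) = V \<inter> {y. G p \<bullet> y = 0}"
    and derg: "(g has_derivative (\<lambda>v. v)) (at (\<psi> p))"
    by (rule regular_level_set_chart[OF der cont p(2)])
  have "\<psi> p \<in> V \<inter> {y. G p \<bullet> y = 0}"
    using img U(2) p(1) by blast
  then have \<psi>p: "\<psi> p \<in> V" "G p \<bullet> \<psi> p = 0" by auto
  have "open ((\<lambda>t. \<psi> p + t *\<^sub>R v) -` V)"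
    by (intro open_vimage V continuous_intros)
  moreover have "(0::real) \<in> (\<lambda>t. \<psi> p + t *\<^sub>R v) -` V" using \<psi>p by simp
  ultimately obtain e where e: "e > 0" "ball 0 e \<subseteq> (\<lambda>t. \<psi> p + t *\<^sub>R v) -` V"
    by (meson openE)
  then have inV: "\<psi> p + t *\<^sub>R v \<in> V" if "t \<in> {-e<..<e}" for t
    using that by (auto simp: subset_iff)
  define \<gamma> where "\<gamma> t = g (\<psi> p + t *\<^sub>R v)" for t
  have "C1_on {-e<..<e} \<gamma>"
    unfolding \<gamma>_def using C1 inV by (rule C1_on_compose_line)
  moreover have "\<gamma> t \<in> {x. h x = 0}" if "t \<in> {-e<..<e}" for t
  proof -
    have "\<psi> p + t *\<^sub>R v \<in> \<psi> ` ({x. h x = 0} \<inter> U)"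
      unfolding img using inV[OF that] v \<psi>p by (simp add: inner_add_right)
    then obtain x where "x \<in> {x. h x = 0} \<inter> U" "\<psi> p + t *\<^sub>R v = \<psi> x" by blast
    then show ?thesis
      using hom by (simp add: \<gamma>_def homeomorphism_def)
  qed
  moreover have "\<gamma> 0 = p"
    using hom U(2) by (simp add: \<gamma>_def homeomorphism_def)
  moreover have "(\<gamma> has_vector_derivative v) (at 0)"
  proof -
    have "((\<lambda>t. \<psi> p + t *\<^sub>R v) has_derivative (\<lambda>s. s *\<^sub>R v)) (at 0)"
      by (auto intro!: derivative_eq_intros)
    from has_derivative_compose[OF this, of g] derg show ?thesis
      by (simp add: \<gamma>_def[abs_def] has_vector_derivative_def)
  qed
  ultimately show "v \<in> tangent_space {x. h x = 0} p"
    unfolding tangent_space_def using e(1) by blast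
qed

section \<open>Local expansion and Lipschitz bounds for C1 maps\<close>

text \<open>Let the derivative at \<open>p\<close> expand norms by at least \<open>B\<close>. By
  continuity of the derivative, subtracting this linear map from \<open>f\<close> leaves a map with
  Lipschitz constant \<open>B / 2\<close> near \<open>p\<close>, so \<open>f\<close> still expands
  by \<open>B / 2\<close> there.\<close>

lemma injective_derivative_locally_expanding:
  fixes f :: "'a::euclidean_space \<Rightarrow> 'b::euclidean_space"
  assumes "C1_on UNIV f" and D: "(f has_derivative D) (at p)" and "\<And>v. D v = 0 \<Longrightarrow> v = 0"
  shows "\<exists>r>0. \<exists>c>0. \<forall>x\<in>ball p r. \<forall>y\<in>ball p r. c * dist x y \<le> dist (f x) (f y)"
proof -
  obtain f' where der: "\<And>x. (f has_derivative blinfun_apply (f' x)) (at x)" and cont: "continuous_on UNIV f'"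
    using assms(1) unfolding C1_on_def by blast
  have inj: "v = 0" if "f' p v = 0" for v
    using assms(3) that has_derivative_unique[OF D der] by simp
  have lin: "linear (blinfun_apply (f' p))"
    by (rule bounded_linear.linear[OF blinfun.bounded_linear_right])
  then have inj: "inj (blinfun_apply (f' p))"
    using inj by (simp add: linear_injective_0)
  obtain B where B: "B > 0" "\<And>v. B * norm v \<le> norm (f' p v)"
    by (rule linear_inj_bounded_below_pos[OF lin inj]) blast
  have "isCont f' p"
    using cont by (simp add: continuous_on_eq_continuous_at)
  then obtain r where r: "r > 0" "\<And>x. dist x p < r \<Longrightarrow> dist (f' x) (f' p) < B / 2"
    unfolding continuous_at_eps_delta using B(1) by (meson half_gt_zero)
  have "B / 2 * dist x y \<le> dist (f x) (f y)" if "x \<in> ball p r" "y \<in> ball p r" for x y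
  proof -
    have "norm ((f x - f' p x) - (f y - f' p y)) \<le> B / 2 * norm (x - y)"
    proof (rule differentiable_bound[OF convex_ball _ _ that])
      fix z assume z: "z \<in> ball p r"
      show "((\<lambda>x. f x - f' p x) has_derivative blinfun_apply (f' z - f' p)) (at z within ball p r)"
        unfolding blinfun.diff_left
        by (intro has_derivative_diff has_derivative_at_withinI[OF der] bounded_linear_imp_has_derivative blinfun.bounded_linear_right)
      have "dist (f' z) (f' p) < B / 2"
        using r(2)[of z] z by (simp add: dist_commute)
      then show "onorm (blinfun_apply (f' z - f' p)) \<le> B / 2"
        unfolding dist_norm norm_blinfun.rep_eq by simp
    qed
    moreover have "norm (f' p (x - y)) \<le> norm (f x - f y) + norm ((f x - f' p x) - (f y - f' p y))"
      using norm_triangle_ineq4[of "f x - f y" "(f x - f' p x) - (f y - f' p y)"]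
      by (simp add: blinfun.diff_right)
    ultimately show ?thesis
      using B(2)[of "x - y"] by (simp add: dist_norm)
  qed
  with r(1) B(1) show ?thesis
    by (intro exI[of _ r] conjI exI[of _ "B / 2"] ballI) auto
qed

text \<open>The derivative is bounded on the compact ball, and convexity permits the mean value
  inequality. This makes the composition with a bounded piece of a Lipschitz curve
  Lipschitz.\<close>

lemma C1_on_lipschitz_on_cball:
  fixes f :: "'a::euclidean_space \<Rightarrow> 'b::real_normed_vector"
  assumes "C1_on UNIV f"
  obtains L where "L-lipschitz_on (cball p R) f"
proof -
  obtain f' where der: "\<And>x. (f has_derivative blinfun_apply (f' x)) (at x)" and cont: "continuous_on UNIV f'"
    using assms unfolding C1_on_def by blast
  have "bounded (f' ` cball p R)"
    by (intro compact_imp_bounded compact_continuous_image continuous_on_subset[OF cont]) auto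
  then obtain B where B: "B > 0" "\<And>x. x \<in> cball p R \<Longrightarrow> norm (f' x) \<le> B"
    by (auto simp: bounded_pos)
  have "B-lipschitz_on (cball p R) f"
  proof (rule lipschitz_onI)
    fix x y assume "x \<in> cball p R" "y \<in> cball p R"
    then show "dist (f x) (f y) \<le> B * dist x y"
      unfolding dist_norm
      by (intro differentiable_bound[OF convex_cball has_derivative_at_withinI[OF der]])
        (use B(2) in \<open>simp_all add: norm_blinfun.rep_eq\<close>)
  qed (use B in simp)
  then show ?thesis by (rule that)
qed

section \<open>Rectifiable sets and coordinate projections\<close>

text \<open>\<open>E0\<close> is the part of \<open>E\<close> on the curves. Each curve is cut to
  the parameter intervals \<open>{- real m..real m}\<close>, on which its composition with
  \<open>H\<close> is Lipschitz, and the result on null coordinate projections applies to each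
  piece.\<close>

lemma rectifiable1_coordinates_null:
  fixes H :: "'a::euclidean_space \<Rightarrow> 'b::euclidean_space"
  assumes "rectifiable1 E" and "C1_on UNIV H"
    and null: "\<And>i. i \<in> Basis \<Longrightarrow> hausdorff1 ((\<lambda>x. H x \<bullet> i) ` E) = 0"
  obtains E0 where "E0 \<subseteq> E" "hausdorff1 (E - E0) = 0" "hausdorff1 (H ` E0) = 0"
proof -
  obtain f :: "nat \<Rightarrow> real \<Rightarrow> 'a" where f: "\<And>j. \<exists>L. L-lipschitz_on UNIV (f j)"
      "hausdorff1 (E - (\<Union>j. range (f j))) = 0"
    using assms(1) unfolding rectifiable1_def by blast
  have "hausdorff1 (H ` f j ` {t \<in> {- real m..real m}. f j t \<in> E}) = 0" for j m
  proof -
    define A where "A = {t \<in> {- real m..real m}. f j t \<in> E}"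
    obtain L1 where L1: "L1-lipschitz_on {- real m..real m} (f j)"
      using f(1)[of j] lipschitz_on_subset by blast
    have "bounded (f j ` {- real m..real m})"
      using lipschitz_on_continuous_on[OF L1] by (intro compact_imp_bounded compact_continuous_image) auto
    then obtain R where "\<forall>y \<in> f j ` {- real m..real m}. norm y \<le> R"
      unfolding bounded_iff by blast
    then have R: "f j ` {- real m..real m} \<subseteq> cball 0 R" by auto
    obtain L2 where "L2-lipschitz_on (cball 0 R) H"
      using C1_on_lipschitz_on_cball[OF assms(2)] by blast
    then have "L2-lipschitz_on (f j ` {- real m..real m}) H"
      using R by (rule lipschitz_on_subset)
    then have L: "(L2 * L1)-lipschitz_on {- real m..real m} (\<lambda>t. H (f j t))"
      using lipschitz_on_compose2[OF L1] by blast
    have "hausdorff1 ((\<lambda>t. H (f j t)) ` A) = 0"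
    proof (rule hausdorff1_lipschitz_curve_null[OF L])
      show "A \<subseteq> {- real m..real m}" by (auto simp: A_def)
      fix i :: 'b assume "i \<in> Basis"
      then show "negligible ((\<lambda>t. H (f j t) \<bullet> i) ` A)"
        by (intro hausdorff1_null_imp_negligible hausdorff1_null_subset[OF null]) (auto simp: A_def)
    qed
    then show ?thesis by (simp add: A_def image_image)
  qed
  then have "hausdorff1 (\<Union>j m. H ` f j ` {t \<in> {- real m..real m}. f j t \<in> E}) = 0"
    by (intro hausdorff1_null_UN)
  moreover have "H ` (E \<inter> (\<Union>j. range (f j))) \<subseteq> (\<Union>j m. H ` f j ` {t \<in> {- real m..real m}. f j t \<in> E})"
  proof clarify
    fix j t assume "f j t \<in> E"
    obtain m where "\<bar>t\<bar> \<le> real m" using real_arch_simple by blast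
    then have "t \<in> {t \<in> {- real m..real m}. f j t \<in> E}" using \<open>f j t \<in> E\<close> by auto
    then show "H (f j t) \<in> (\<Union>j m. H ` f j ` {t \<in> {- real m..real m}. f j t \<in> E})" by blast
  qed
  ultimately have "hausdorff1 (H ` (E \<inter> (\<Union>j. range (f j)))) = 0"
    by (rule hausdorff1_null_subset)
  moreover have "hausdorff1 (E - E \<inter> (\<Union>j. range (f j))) = 0"
    using f(2) by (simp add: Diff_Int)
  ultimately show ?thesis
    using that[of "E \<inter> (\<Union>j. range (f j))"] by blast
qed

text \<open>By the Lindelof property, countably many open sets, each with a single expansion factor,
  cover \<open>E\<close>.\<close>

lemma hausdorff1_null_locally_expanding:
  fixes f :: "'a::euclidean_space \<Rightarrow> 'b::metric_space"
  assumes loc: "\<And>p. p \<in> E \<Longrightarrow> \<exists>r>0. \<exists>c>0. \<forall>x \<in> E \<inter> ball p r. \<forall>y \<in> E \<inter> ball p r. c * dist x y \<le> dist (f x) (f y)"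
    and null: "hausdorff1 (f ` E) = 0"
  shows "hausdorff1 E = 0"
proof -
  define \<F> where "\<F> = {B. open B \<and> (\<exists>c>0. \<forall>x \<in> E \<inter> B. \<forall>y \<in> E \<inter> B. c * dist x y \<le> dist (f x) (f y))}"
  obtain \<G> where \<G>: "\<G> \<subseteq> \<F>" "countable \<G>" "\<Union>\<G> = \<Union>\<F>"
    using Lindelof[of \<F>] by (auto simp: \<F>_def)
  have "hausdorff1 (E \<inter> B) = 0" if B: "B \<in> \<G>" for B
  proof -
    obtain c where c: "c > 0" "\<forall>x \<in> E \<inter> B. \<forall>y \<in> E \<inter> B. c * dist x y \<le> dist (f x) (f y)"
      using \<G>(1) B unfolding \<F>_def by blast
    then show ?thesis
      by (intro hausdorff1_null_expanding[OF c(1), of _ f] hausdorff1_null_subset[OF null]) auto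
  qed
  then have "hausdorff1 (\<Union>B\<in>\<G>. E \<inter> B) = 0"
    by (rule hausdorff1_null_countable_UN[OF \<G>(2)])
  moreover have "E \<subseteq> (\<Union>B\<in>\<G>. E \<inter> B)"
  proof
    fix p assume "p \<in> E"
    then obtain r where "r > 0" "ball p r \<in> \<F>"
      using loc[of p] unfolding \<F>_def by auto
    then have "p \<in> \<Union>\<G>" unfolding \<G>(3) using centre_in_ball by blast
    then show "p \<in> (\<Union>B\<in>\<G>. E \<inter> B)" using \<open>p \<in> E\<close> by blast
  qed
  ultimately show ?thesis by (rule hausdorff1_null_subset)
qed

text \<open>To be applied with the encoding map as \<open>H\<close> and its Jacobian determinant as
  \<open>h\<close>. Then \<open>off\<close> is injectivity of the derivative at noncritical points,
  and \<open>on\<close> says that no nonzero kernel vector at a critical point is annihilated by the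
  derivative of \<open>h\<close>.\<close>

lemma rectifiable1_projection_positive:
  fixes H :: "'a::euclidean_space \<Rightarrow> 'b::euclidean_space" and h :: "'a \<Rightarrow> real"
  assumes E: "rectifiable1 E" "hausdorff1 E > 0"
    and H: "C1_on UNIV H" "\<And>x. (H has_derivative DH x) (at x)"
    and h: "C1_on UNIV h" "\<And>x. (h has_derivative Dh x) (at x)"
    and off: "\<And>x v. h x \<noteq> 0 \<Longrightarrow> DH x v = 0 \<Longrightarrow> v = 0"
    and on: "\<And>x v. h x = 0 \<Longrightarrow> DH x v = 0 \<Longrightarrow> Dh x v = 0 \<Longrightarrow> v = 0"
  shows "\<exists>i\<in>Basis. hausdorff1 ((\<lambda>x. H x \<bullet> i) ` E) > 0"
proof (rule ccontr)
  assume "\<not> ?thesis"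
  then have null: "hausdorff1 ((\<lambda>x. H x \<bullet> i) ` E) = 0" if "i \<in> Basis" for i
    using that by (simp add: not_gr_zero)
  obtain E0 where E0: "E0 \<subseteq> E" "hausdorff1 (E - E0) = 0" "hausdorff1 (H ` E0) = 0"
    using rectifiable1_coordinates_null[OF E(1) H(1) null] by blast
  have "hausdorff1 (E0 \<inter> {x. h x \<noteq> 0}) = 0"
  proof (rule hausdorff1_null_locally_expanding)
    fix p assume p: "p \<in> E0 \<inter> {x. h x \<noteq> 0}"
    then have "v = 0" if "DH p v = 0" for v
      using off that by blast
    then obtain r c where "r > 0" "c > 0" "\<forall>x\<in>ball p r. \<forall>y\<in>ball p r. c * dist x y \<le> dist (H x) (H y)"
      using injective_derivative_locally_expanding[OF H, of p] by auto
    then show "\<exists>r>0. \<exists>c>0. \<forall>x \<in> E0 \<inter> {x. h x \<noteq> 0} \<inter> ball p r. \<forall>y \<in> E0 \<inter> {x. h x \<noteq> 0} \<inter> ball p r.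
        c * dist x y \<le> dist (H x) (H y)"
      by blast
  qed (rule hausdorff1_null_subset[OF E0(3)], blast)
  moreover have "hausdorff1 (E0 \<inter> {x. h x = 0}) = 0"
  proof (rule hausdorff1_null_locally_expanding)
    \<comment> \<open>On the zero set of \<open>h\<close>, distances between values of \<open>K\<close> and of \<open>H\<close> agree.\<close>
    define K where "K x = (H x, h x)" for x
    have DK: "(K has_derivative (\<lambda>v. (DH x v, Dh x v))) (at x)" for x
      unfolding K_def[abs_def] by (intro has_derivative_Pair H(2) h(2))
    have C1K: "C1_on UNIV K"
      unfolding K_def[abs_def] using H(1) h(1) by (rule C1_on_Pair)
    fix p assume p: "p \<in> E0 \<inter> {x. h x = 0}"
    then have "v = 0" if "(DH p v, Dh p v) = 0" for v
      using on that by (auto simp: zero_prod_def)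
    then obtain r c where "r > 0" "c > 0" "\<forall>x\<in>ball p r. \<forall>y\<in>ball p r. c * dist x y \<le> dist (K x) (K y)"
      using injective_derivative_locally_expanding[OF C1K DK, of p] by auto
    moreover have "dist (K x) (K y) = dist (H x) (H y)" if "h x = 0" "h y = 0" for x y
      using that by (simp add: K_def dist_Pair_Pair)
    ultimately show "\<exists>r>0. \<exists>c>0. \<forall>x \<in> E0 \<inter> {x. h x = 0} \<inter> ball p r. \<forall>y \<in> E0 \<inter> {x. h x = 0} \<inter> ball p r.
        c * dist x y \<le> dist (H x) (H y)"
      by (metis (mono_tags, lifting) IntE mem_Collect_eq)
  qed (rule hausdorff1_null_subset[OF E0(3)], blast)
  ultimately have "hausdorff1 ((E0 \<inter> {x. h x \<noteq> 0}) \<union> (E0 \<inter> {x. h x = 0}) \<union> (E - E0)) = 0"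
    using E0(2) by (intro hausdorff1_null_Un)
  then have "hausdorff1 E = 0"
    by (rule hausdorff1_null_subset) auto
  with E(2) show False by simp
qed

section \<open>Polar polytopes and exponential weights\<close>

lemma is_norm_sum_le:
  assumes "is_norm \<rho>" "finite A"
  shows "\<rho> (\<Sum>a\<in>A. f a) \<le> (\<Sum>a\<in>A. \<rho> (f a))"
  using assms(2)
proof induction
  case empty
  have "\<rho> 0 = 0" using assms(1) by (metis is_norm_def)
  then show ?case by simp
next
  case (insert a A)
  have "\<rho> (f a + sum f A) \<le> \<rho> (f a) + \<rho> (sum f A)"
    using assms(1) by (simp add: is_norm_def)
  then show ?case using insert by simp
qed

text \<open>Expansion in the standard basis; this half of the equivalence of norms is what bounds
  the polar set.\<close>

lemma is_norm_bounded_by_norm: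
  fixes \<rho> :: "'a::euclidean_space \<Rightarrow> real"
  assumes "is_norm \<rho>"
  obtains C where "C > 0" "\<And>x. \<rho> x \<le> C * norm x"
proof
  define C where "C = 1 + (\<Sum>b\<in>Basis. \<rho> b)"
  have nonneg: "\<rho> x \<ge> 0" and scale: "\<rho> (c *\<^sub>R x) = \<bar>c\<bar> * \<rho> x" for c x
    using assms by (auto simp: is_norm_def)
  show "C > 0"
    using nonneg by (simp add: C_def add_pos_nonneg sum_nonneg)
  fix x
  have "\<rho> x = \<rho> (\<Sum>b\<in>Basis. (x \<bullet> b) *\<^sub>R b)"
    by (simp add: euclidean_representation)
  also have "\<dots> \<le> (\<Sum>b\<in>Basis. \<rho> ((x \<bullet> b) *\<^sub>R b))"
    by (rule is_norm_sum_le[OF assms]) simp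
  also have "\<dots> \<le> (\<Sum>b\<in>Basis. norm x * \<rho> b)"
    unfolding scale by (intro sum_mono mult_right_mono Basis_le_norm nonneg)
  also have "\<dots> \<le> C * norm x"
    by (simp add: C_def algebra_simps flip: sum_distrib_left)
  finally show "\<rho> x \<le> C * norm x" .
qed

lemma polar_set_convex_hull: "polar_set (convex hull V) = polar_set V"
proof (intro subset_antisym subsetI)
  fix \<xi> assume "\<xi> \<in> polar_set (convex hull V)"
  then show "\<xi> \<in> polar_set V"
    by (simp add: polar_set_def hull_inc)
next
  fix \<xi> assume "\<xi> \<in> polar_set V"
  then have "convex hull V \<subseteq> {x. \<xi> \<bullet> x \<le> 1}"
    by (intro hull_minimal convex_halfspace_le) (auto simp: polar_set_def)
  then show "\<xi> \<in> polar_set (convex hull V)"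
    by (auto simp: polar_set_def)
qed

text \<open>The polar of a convex hull is the polar of its generators, hence a finite intersection
  of half-spaces.\<close>

lemma polyhedron_polar_set_polytope:
  fixes P :: "'a::euclidean_space set"
  assumes "polytope P"
  shows "polyhedron (polar_set P)"
proof -
  obtain V where V: "finite V" "P = convex hull V"
    using assms by (auto simp: polytope_def)
  have "polar_set V = \<Inter> ((\<lambda>x. {\<xi>. x \<bullet> \<xi> \<le> 1}) ` V)"
    by (auto simp: polar_set_def inner_commute)
  moreover have "polyhedron (\<Inter> ((\<lambda>x. {\<xi>. x \<bullet> \<xi> \<le> 1}) ` V))"
    using V(1) by (intro polyhedron_Inter) (auto intro: polyhedron_halfspace_le)
  ultimately show ?thesis
    by (simp add: V(2) polar_set_convex_hull)
qed

lemma bounded_polar_set_unit_ball: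
  fixes \<rho> :: "'a::euclidean_space \<Rightarrow> real"
  assumes "is_norm \<rho>"
  shows "bounded (polar_set (unit_ball \<rho>))"
proof -
  obtain C where C: "C > 0" "\<And>x. \<rho> x \<le> C * norm x"
    using is_norm_bounded_by_norm[OF assms] by blast
  have "norm \<xi> \<le> C" if \<xi>: "\<xi> \<in> polar_set (unit_ball \<rho>)" for \<xi>
  proof (cases "\<xi> = 0")
    case False
    \<comment> \<open>A multiple of \<open>\<xi>\<close> scaled into the unit ball; pairing
      \<open>\<xi>\<close> with it bounds the norm of \<open>\<xi>\<close>.\<close>
    define x where "x = (1 / (C * norm \<xi>)) *\<^sub>R \<xi>"
    have "C * norm x = 1" using False C(1) by (simp add: x_def)
    then have "x \<in> unit_ball \<rho>" using C(2)[of x] by (simp add: unit_ball_def)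
    then have "\<xi> \<bullet> x \<le> 1" using \<xi> by (simp add: polar_set_def)
    moreover have "\<xi> \<bullet> x = norm \<xi> / C"
      using False C(1) by (simp add: x_def dot_square_norm power2_eq_square)
    ultimately show ?thesis using C(1) by (simp add: divide_le_eq)
  qed (use C(1) in simp)
  then show ?thesis by (auto simp: bounded_iff)
qed

text \<open>The polar set is a compact polyhedron, so it has finitely many extreme points and is
  their convex hull. If \<open>v\<close> were constant on them, it would be constant on the whole
  polar set; the value is 0 because the origin belongs to it, and a small positive multiple of
  \<open>v\<close> belongs to it because the unit ball is bounded.\<close>

lemma polar_vertices_polyhedral_norm:
  fixes \<rho> :: "'a::euclidean_space \<Rightarrow> real"
  assumes "polyhedral_norm \<rho>"
  shows finite_polar_vertices: "finite (polar_vertices \<rho>)"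
    and polar_vertices_nonempty: "polar_vertices \<rho> \<noteq> {}"
    and polar_vertices_separate: "(\<And>u. u \<in> polar_vertices \<rho> \<Longrightarrow> u \<bullet> v = k) \<Longrightarrow> v = 0"
proof -
  have nrm: "is_norm \<rho>" and P: "polytope (unit_ball \<rho>)"
    using assms by (auto simp: polyhedral_norm_def)
  have poly: "polyhedron (polar_set (unit_ball \<rho>))"
    by (rule polyhedron_polar_set_polytope[OF P])
  show "finite (polar_vertices \<rho>)"
    unfolding polar_vertices_def by (rule finite_polyhedron_extreme_points[OF poly])
  have KM: "polar_set (unit_ball \<rho>) = convex hull (polar_vertices \<rho>)"
    unfolding polar_vertices_def
    using poly bounded_polar_set_unit_ball[OF nrm]
    by (intro Krein_Milman_Minkowski) (auto simp: compact_eq_bounded_closed polyhedron_imp_closed polyhedron_imp_convex)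
  have "0 \<in> polar_set (unit_ball \<rho>)" by (simp add: polar_set_def)
  then show "polar_vertices \<rho> \<noteq> {}"
    using KM by auto
  assume "\<And>u. u \<in> polar_vertices \<rho> \<Longrightarrow> u \<bullet> v = k"
  then have "convex hull (polar_vertices \<rho>) \<subseteq> {\<xi>. v \<bullet> \<xi> = k}"
    by (intro hull_minimal convex_hyperplane) (auto simp: inner_commute)
  then have const: "v \<bullet> \<xi> = k" if "\<xi> \<in> polar_set (unit_ball \<rho>)" for \<xi>
    using KM that by blast
  have "k = 0" using const[OF \<open>0 \<in> _\<close>] by simp
  have "bounded (unit_ball \<rho>)"
    using P by (rule polytope_imp_bounded)
  then obtain R where R: "R > 0" "\<And>x. x \<in> unit_ball \<rho> \<Longrightarrow> norm x \<le> R"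
    by (auto simp: bounded_pos)
  show "v = 0"
  proof (rule ccontr)
    assume "v \<noteq> 0"
    define c where "c = 1 / (norm v * R)"
    have "c > 0" using R(1) \<open>v \<noteq> 0\<close> by (simp add: c_def)
    have "(c *\<^sub>R v) \<bullet> x \<le> 1" if "x \<in> unit_ball \<rho>" for x
    proof -
      have "v \<bullet> x \<le> norm v * R"
        using R(2)[OF that] norm_cauchy_schwarz[of v x] by (meson mult_left_mono norm_ge_zero order_trans)
      then show ?thesis
        using R(1) \<open>v \<noteq> 0\<close> by (simp add: c_def divide_le_eq)
    qed
    then have "c *\<^sub>R v \<in> polar_set (unit_ball \<rho>)"
      by (simp add: polar_set_def)
    from const[OF this] show False
      using \<open>c > 0\<close> \<open>v \<noteq> 0\<close> \<open>k = 0\<close> by simp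
  qed
qed

section \<open>Mean and covariance under exponential weights\<close>

text \<open>\<open>U\<close> is to be the set of polar vertices; \<open>separates\<close> says that
  no hyperplane, through the origin or not, contains \<open>U\<close>.\<close>

locale exponential_weights =
  fixes U :: "'a::euclidean_space set" and \<epsilon> :: real
  assumes finite_U: "finite U" and U_nonempty: "U \<noteq> {}" and eps_pos: "\<epsilon> > 0"
    and separates: "(\<And>u. u \<in> U \<Longrightarrow> u \<bullet> v = k) \<Longrightarrow> v = 0"
begin

definition W :: "'a \<Rightarrow> real" where "W z = (\<Sum>u\<in>U. exp ((u \<bullet> z) / \<epsilon>))"

definition prob :: "'a \<Rightarrow> 'a \<Rightarrow> real" where "prob z u = exp ((u \<bullet> z) / \<epsilon>) / W z"

definition mean :: "'a \<Rightarrow> 'a" where "mean z = (\<Sum>u\<in>U. prob z u *\<^sub>R u)"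

text \<open>The covariance operator of the weights, divided by \<open>\<epsilon>\<close>. Only one
  factor is centred: the coefficients sum to zero, so centring the other would change
  nothing.\<close>

definition hess :: "'a \<Rightarrow> 'a \<Rightarrow> 'a" where
  "hess z v = (\<Sum>u\<in>U. (prob z u * (u \<bullet> v - mean z \<bullet> v) / \<epsilon>) *\<^sub>R u)"

lemma W_pos: "W z > 0"
  unfolding W_def using finite_U U_nonempty by (intro sum_pos) auto

lemma prob_pos: "prob z u > 0"
  using W_pos by (simp add: prob_def)

lemma sum_prob: "(\<Sum>u\<in>U. prob z u) = 1"
  using W_pos[of z] unfolding prob_def by (simp add: W_def flip: sum_divide_distrib)

lemma mean_inner: "mean z \<bullet> v = (\<Sum>u\<in>U. prob z u * (u \<bullet> v))"
  by (simp add: mean_def inner_sum_left)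

lemma sum_exp_inner: "(\<Sum>u\<in>U. exp ((u \<bullet> z) / \<epsilon>) * ((u \<bullet> v) / \<epsilon>)) = W z * (mean z \<bullet> v) / \<epsilon>"
proof -
  have "W z * (mean z \<bullet> v) / \<epsilon> = (\<Sum>u\<in>U. W z * (prob z u * (u \<bullet> v)) / \<epsilon>)"
    by (simp add: mean_inner sum_distrib_left sum_divide_distrib)
  also have "\<dots> = (\<Sum>u\<in>U. exp ((u \<bullet> z) / \<epsilon>) * ((u \<bullet> v) / \<epsilon>))"
    using W_pos[of z] by (intro sum.cong) (auto simp: prob_def)
  finally show ?thesis ..
qed

lemma exp_inner_has_derivative:
  "((\<lambda>z. exp ((u \<bullet> z) / \<epsilon>)) has_derivative (\<lambda>v. exp ((u \<bullet> z) / \<epsilon>) * ((u \<bullet> v) / \<epsilon>))) (at z)"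
proof -
  have "((\<lambda>z. (u \<bullet> z) / \<epsilon>) has_derivative (\<lambda>v. (u \<bullet> v) / \<epsilon>)) (at z)"
    by (intro bounded_linear_imp_has_derivative bounded_linear_divide[THEN bounded_linear_compose] bounded_linear_inner_right)
  from has_derivative_exp[OF this] show ?thesis
    by (simp add: mult.commute)
qed

lemma W_has_derivative: "(W has_derivative (\<lambda>v. W z * (mean z \<bullet> v) / \<epsilon>)) (at z)"
proof -
  have "((\<lambda>z. \<Sum>u\<in>U. exp ((u \<bullet> z) / \<epsilon>)) has_derivative
      (\<lambda>v. \<Sum>u\<in>U. exp ((u \<bullet> z) / \<epsilon>) * ((u \<bullet> v) / \<epsilon>))) (at z)"
    by (intro has_derivative_sum exp_inner_has_derivative)
  then show ?thesis
    unfolding sum_exp_inner by (simp add: W_def[abs_def])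
qed

text \<open>The factor \<open>c\<close> stands for the normalization by the number of vertices; it
  cancels in the derivative of the logarithm.\<close>

lemma lse_has_derivative:
  assumes "c > 0"
  shows "((\<lambda>z. \<epsilon> * ln (c * W z)) has_derivative (\<lambda>v. mean z \<bullet> v)) (at z)"
proof -
  have "((\<lambda>z. \<epsilon> * ln (c * W z)) has_derivative
      (\<lambda>v. \<epsilon> * ((c * (W z * (mean z \<bullet> v) / \<epsilon>)) * inverse (c * W z)))) (at z)"
    using assms W_pos[of z]
    by (intro has_derivative_mult_right has_derivative_ln W_has_derivative) simp
  moreover have "\<epsilon> * ((c * (W z * (mean z \<bullet> v) / \<epsilon>)) * inverse (c * W z)) = mean z \<bullet> v" for v
    using assms W_pos[of z] eps_pos by (simp add: field_simps)
  ultimately show ?thesis by simp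
qed

lemma prob_has_derivative:
  "((\<lambda>z. prob z u) has_derivative (\<lambda>v. prob z u * (u \<bullet> v - mean z \<bullet> v) / \<epsilon>)) (at z)"
proof -
  have "((\<lambda>z. prob z u) has_derivative
      (\<lambda>v. (exp ((u \<bullet> z) / \<epsilon>) * ((u \<bullet> v) / \<epsilon>) * W z - exp ((u \<bullet> z) / \<epsilon>) * (W z * (mean z \<bullet> v) / \<epsilon>)) / (W z * W z))) (at z)"
    unfolding prob_def using W_pos[of z]
    by (intro has_derivative_divide' exp_inner_has_derivative W_has_derivative) simp
  moreover have "(exp ((u \<bullet> z) / \<epsilon>) * ((u \<bullet> v) / \<epsilon>) * W z - exp ((u \<bullet> z) / \<epsilon>) * (W z * (mean z \<bullet> v) / \<epsilon>)) / (W z * W z)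
      = prob z u * (u \<bullet> v - mean z \<bullet> v) / \<epsilon>" for v
    using W_pos[of z] eps_pos by (simp add: prob_def field_simps)
  ultimately show ?thesis by simp
qed

lemma mean_has_derivative: "(mean has_derivative hess z) (at z)"
proof -
  have "((\<lambda>z. \<Sum>u\<in>U. prob z u *\<^sub>R u) has_derivative hess z) (at z)"
    unfolding hess_def[abs_def]
    by (intro has_derivative_sum has_derivative_scaleR_left prob_has_derivative)
  then show ?thesis
    unfolding mean_def[abs_def] .
qed

lemma hess_inner:
  "hess z v \<bullet> w = ((\<Sum>u\<in>U. prob z u * (u \<bullet> v) * (u \<bullet> w)) - (mean z \<bullet> v) * (mean z \<bullet> w)) / \<epsilon>"
proof -
  have "hess z v \<bullet> w = (\<Sum>u\<in>U. (prob z u * (u \<bullet> v) * (u \<bullet> w) - (mean z \<bullet> v) * (prob z u * (u \<bullet> w))) / \<epsilon>)"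
    unfolding hess_def inner_sum_left by (intro sum.cong) (auto simp: algebra_simps)
  also have "\<dots> = ((\<Sum>u\<in>U. prob z u * (u \<bullet> v) * (u \<bullet> w)) - (mean z \<bullet> v) * (\<Sum>u\<in>U. prob z u * (u \<bullet> w))) / \<epsilon>"
    by (simp add: sum_divide_distrib[symmetric] sum_subtractf sum_distrib_left)
  finally show ?thesis by (simp add: mean_inner)
qed

lemma hess_symmetric: "hess z v \<bullet> w = hess z w \<bullet> v"
  unfolding hess_inner by (simp add: mult_ac)

text \<open>Up to the factor \<open>1 / \<epsilon>\<close> this is the variance of
  \<open>u \<bullet> v\<close> under positive weights, which vanishes only if
  \<open>u \<bullet> v\<close> is constant on \<open>U\<close>.\<close>

lemma hess_positive_definite:
  assumes "v \<noteq> 0"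
  shows "hess z v \<bullet> v > 0"
proof -
  define m where "m = mean z \<bullet> v"
  obtain u0 where u0: "u0 \<in> U" "u0 \<bullet> v \<noteq> m"
    using separates assms by blast
  have "0 < (\<Sum>u\<in>U. prob z u * (u \<bullet> v - m)\<^sup>2)"
    using finite_U u0 prob_pos[of z]
    by (intro sum_pos2[of _ u0]) (auto simp: less_imp_le)
  also have "\<dots> = (\<Sum>u\<in>U. prob z u * (u \<bullet> v) * (u \<bullet> v) - 2 * m * (prob z u * (u \<bullet> v)) + m\<^sup>2 * prob z u)"
    by (intro sum.cong) (auto simp: power2_eq_square algebra_simps)
  also have "\<dots> = (\<Sum>u\<in>U. prob z u * (u \<bullet> v) * (u \<bullet> v)) - 2 * m * m + m\<^sup>2"
    by (simp add: sum.distrib sum_subtractf sum_prob m_def mean_inner flip: sum_distrib_left)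
  also have "\<dots> = \<epsilon> * (hess z v \<bullet> v)"
    using eps_pos by (simp add: hess_inner m_def power2_eq_square)
  finally show ?thesis using eps_pos by (simp add: zero_less_mult_iff)
qed

lemma continuous_on_prob: "continuous_on S (\<lambda>z. prob z u)"
proof -
  have "\<epsilon> \<noteq> 0" "\<forall>z\<in>S. W z \<noteq> 0"
    using eps_pos W_pos by (auto simp: less_imp_neq[symmetric])
  then show ?thesis
    unfolding prob_def W_def by (intro continuous_intros) auto
qed

lemma continuous_on_mean: "continuous_on S mean"
  unfolding mean_def[abs_def] by (intro continuous_intros continuous_on_prob)

lemma continuous_on_hess: "continuous_on S (\<lambda>z. hess z v)"
  unfolding hess_def using eps_pos by (intro continuous_intros continuous_on_prob continuous_on_mean) auto

end

section \<open>Determinants of affinely independent families\<close>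

lemma affinely_independent_family_differences:
  fixes g :: "'n::finite \<Rightarrow> 'a::real_vector"
  assumes "affinely_independent_family g" and sum0: "(\<Sum>i\<in>UNIV - {i0}. c i *\<^sub>R (g i0 - g i)) = 0" and "i \<noteq> i0"
  shows "c i = 0"
proof (rule ccontr)
  assume "c i \<noteq> 0"
  have g: "inj g" "\<not> affine_dependent (range g)"
    using assms(1) by (auto simp: affinely_independent_family_def)
  \<comment> \<open>The coefficients of the corresponding affine relation among the
    \<open>g j\<close>; the one at \<open>i0\<close> is chosen to make the total zero.\<close>
  define u where "u j = (if j = i0 then (\<Sum>k\<in>UNIV - {i0}. c k) else - c j)" for j
  have "sum u UNIV = u i0 + sum u (UNIV - {i0})"
    by (rule sum.remove) auto
  also have "sum u (UNIV - {i0}) = (\<Sum>k\<in>UNIV - {i0}. - c k)"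
    by (intro sum.cong) (auto simp: u_def)
  finally have "sum u UNIV = 0"
    by (simp add: u_def sum_negf)
  moreover have "(\<Sum>j\<in>UNIV. u j *\<^sub>R g j) = u i0 *\<^sub>R g i0 + (\<Sum>j\<in>UNIV - {i0}. u j *\<^sub>R g j)"
    by (rule sum.remove) auto
  moreover have "(\<Sum>j\<in>UNIV - {i0}. u j *\<^sub>R g j) = (\<Sum>j\<in>UNIV - {i0}. - (c j *\<^sub>R g j))"
    by (intro sum.cong) (auto simp: u_def)
  ultimately have "sum u UNIV = 0" "(\<Sum>j\<in>UNIV. u j *\<^sub>R g j) = 0"
    using sum0 by (simp_all add: u_def scaleR_sum_left scaleR_diff_right sum_subtractf sum_negf)
  \<comment> \<open>Injectivity of \<open>g\<close> moves the relation from indices to values, as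
    affine dependence is a property of sets.\<close>
  then have "(\<Sum>x\<in>range g. u (inv g x)) = 0" "(\<Sum>x\<in>range g. u (inv g x) *\<^sub>R x) = 0"
    using g(1) by (simp_all add: sum.reindex)
  moreover have "u (inv g (g i)) \<noteq> 0"
    using \<open>c i \<noteq> 0\<close> \<open>i \<noteq> i0\<close> g(1) by (simp add: u_def)
  ultimately have "affine_dependent (range g)"
    by (subst affine_dependent_explicit_finite) (auto intro!: exI[of _ "\<lambda>x. u (inv g x)"])
  with g(2) show False by contradiction
qed

text \<open>Row operations leave \<open>y\<close> in a single row, so the determinant is an affine
  function of \<open>y\<close>. Its linear part is represented by a multiple of the generalized
  cross product of the differences \<open>b i\<close>, which is orthogonal to all of them and spans
  their orthogonal complement.\<close>

lemma det_affinely_independent_family: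
  fixes g :: "'n::finite \<Rightarrow> real^'n"
  assumes g: "affinely_independent_family g"
  obtains w c where "w \<noteq> 0" "\<And>i. w \<bullet> g i = c" "\<And>y. det (\<chi> i. y - g i) = w \<bullet> y - c"
    "\<And>v. (\<And>i j. v \<bullet> g i = v \<bullet> g j) \<Longrightarrow> \<exists>t. v = t *\<^sub>R w"
proof -
  obtain i0 :: 'n where True by simp
  define b where "b i = g i0 - g i" for i
  define B where "B z = (\<chi> i. if i = i0 then z else b i)" for z
  have B_mult: "(B z *v v) $ i = (if i = i0 then z \<bullet> v else b i \<bullet> v)" for z v i
    by (simp add: B_def matrix_vector_mult_def inner_vec_def)
  have linB: "linear (\<lambda>z. det (B z))"
  proof (rule linearI)
    fix x y :: "real^'n" and r :: real
    show "det (B (x + y)) = det (B x) + det (B y)"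
      unfolding B_def by (rule det_row_add)
    show "det (B (r *\<^sub>R x)) = r *\<^sub>R det (B x)"
      unfolding B_def using det_row_mul[of i0 r "\<lambda>_. x" b] by (simp add: scalar_mult_eq_scaleR cong: if_cong)
  qed
  \<comment> \<open>The vector representing the linear form \<open>det (B z)\<close> in
    \<open>z\<close>.\<close>
  define w' where "w' = adjoint (\<lambda>z. det (B z)) 1"
  have detB: "det (B z) = w' \<bullet> z" for z
    using adjoint_works[OF linB, of z 1] by (simp add: w'_def inner_commute)
  \<comment> \<open>Multiplication by \<open>L\<close> adds row \<open>i0\<close> to all others, so that the matrix with rows \<open>y - g i\<close> is
    \<open>L ** B (y - g i0)\<close>, with \<open>y\<close> only in row \<open>i0\<close> of the second factor.\<close>
  define L :: "real^'n^'n" where "L = (\<chi> i j. if j = i \<or> j = i0 then 1 else 0)"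
  have L_mult: "(\<Sum>j\<in>UNIV. L $ i $ j * f j) = (if i = i0 then f i0 else f i + f i0)" for f i
  proof -
    have "(\<Sum>j\<in>UNIV. L $ i $ j * f j) = (\<Sum>j\<in>{i, i0}. f j)"
      unfolding L_def by (rule sum.mono_neutral_cong_right) auto
    then show ?thesis by auto
  qed
  have "invertible L"
    unfolding invertible_left_inverse matrix_left_invertible_ker
  proof (intro allI impI)
    fix v assume "L *v v = 0"
    then have "(if i = i0 then v $ i0 else v $ i + v $ i0) = 0" for i
      using L_mult[of i "\<lambda>j. v $ j"] by (simp add: matrix_vector_mult_def vec_eq_iff)
    then show "v = 0"
      unfolding vec_eq_iff by (metis add.right_neutral zero_index)
  qed
  then have detL: "det L \<noteq> 0" by (simp add: invertible_det_nz)
  have det: "det (\<chi> i. y - g i) = det L * (w' \<bullet> (y - g i0))" for y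
  proof -
    have "(\<chi> i. y - g i) = L ** B (y - g i0)"
      by (simp add: vec_eq_iff matrix_matrix_mult_def L_mult) (simp add: B_def b_def)
    then show ?thesis by (simp add: det_mul detB)
  qed
  have w'b: "w' \<bullet> b i = 0" for i
  proof (cases "i = i0")
    case False
    have "det (B (b i)) = 0"
      using False by (intro det_identical_rows[of i i0]) (auto simp: row_def B_def vec_eq_iff)
    then show ?thesis by (simp add: detB)
  qed (simp add: b_def)
  \<comment> \<open>There are too few differences to span the space, so some \<open>z\<close>
    completes them to a matrix \<open>B z\<close> with independent rows; its determinant shows that
    \<open>w'\<close> is nonzero.\<close>
  have "dim (b ` (UNIV - {i0})) \<le> card (b ` (UNIV - {i0}))"
    by (intro dim_le_card') auto
  also have "\<dots> \<le> card (UNIV - {i0})"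
    by (rule card_image_le) simp
  also have "\<dots> < DIM(real^'n)"
    by (simp add: card_Diff_singleton)
  finally have "span (b ` (UNIV - {i0})) \<noteq> UNIV"
    by (metis dim_UNIV dim_span less_irrefl)
  then obtain z where z: "z \<notin> span (b ` (UNIV - {i0}))" by blast
  have invB: "invertible (B z)"
    unfolding invertible_right_inverse matrix_right_invertible_independent_rows
  proof (intro allI impI)
    fix c i assume "(\<Sum>i\<in>UNIV. c i *s row i (B z)) = 0"
    moreover have "(\<Sum>i\<in>UNIV. c i *s row i (B z)) = c i0 *s row i0 (B z) + (\<Sum>i\<in>UNIV - {i0}. c i *s row i (B z))"
      by (rule sum.remove) auto
    moreover have "(\<Sum>i\<in>UNIV - {i0}. c i *s row i (B z)) = (\<Sum>i\<in>UNIV - {i0}. c i *\<^sub>R b i)"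
      by (intro sum.cong) (auto simp: B_def row_def scalar_mult_eq_scaleR vec_eq_iff)
    moreover have "row i0 (B z) = z"
      by (simp add: B_def row_def vec_eq_iff)
    ultimately have eq: "c i0 *\<^sub>R z + (\<Sum>i\<in>UNIV - {i0}. c i *\<^sub>R b i) = 0"
      by (simp add: scalar_mult_eq_scaleR)
    have span: "(\<Sum>i\<in>UNIV - {i0}. c i *\<^sub>R b i) \<in> span (b ` (UNIV - {i0}))"
      by (intro span_sum span_scale span_base imageI)
    have "c i0 = 0"
    proof (rule ccontr)
      assume "c i0 \<noteq> 0"
      then have "z = (1 / c i0) *\<^sub>R (c i0 *\<^sub>R z)" by simp
      also have "c i0 *\<^sub>R z = - (\<Sum>i\<in>UNIV - {i0}. c i *\<^sub>R b i)"
        using eq by (simp add: eq_neg_iff_add_eq_0)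
      finally have "z \<in> span (b ` (UNIV - {i0}))"
        using span_scale[OF span_neg[OF span]] by metis
      with z show False by contradiction
    qed
    moreover from this eq have "c i = 0" if "i \<noteq> i0"
      using affinely_independent_family_differences[OF g _ that, of c] by (simp add: b_def)
    ultimately show "c i = 0" by blast
  qed
  then have z': "w' \<bullet> z \<noteq> 0"
    by (simp add: invertible_det_nz detB)
  define w where "w = det L *\<^sub>R w'"
  have wb: "w \<bullet> b i = 0" for i by (simp add: w_def w'b)
  show ?thesis
  proof
    show "w \<noteq> 0" using detL z' by (auto simp: w_def)
    show "w \<bullet> g i = w \<bullet> g i0" for i
      using wb[of i] by (simp add: b_def inner_diff_right)
    show "det (\<chi> i. y - g i) = w \<bullet> y - w \<bullet> g i0" for y
      by (simp add: det w_def inner_diff_right algebra_simps)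
    fix v assume v: "\<And>i j. v \<bullet> g i = v \<bullet> g j"
    have vb: "b i \<bullet> v = 0" for i
      using v[of i0 i] by (simp add: b_def inner_diff_left inner_diff_right inner_commute)
    \<comment> \<open>Chosen so that \<open>v - t *\<^sub>R w\<close> is orthogonal to
      \<open>z\<close> as well as to every \<open>b i\<close>, hence lies in the kernel of the
      invertible \<open>B z\<close>.\<close>
    define t where "t = (z \<bullet> v) / (z \<bullet> w)"
    have "z \<bullet> w \<noteq> 0" using detL z' by (simp add: w_def inner_commute)
    moreover have "b i \<bullet> w = 0" for i using wb[of i] by (simp add: inner_commute)
    ultimately have "B z *v (v - t *\<^sub>R w) = 0"
      by (simp add: vec_eq_iff B_mult inner_diff_right vb t_def)
    then have "v - t *\<^sub>R w = 0"
      using invB unfolding invertible_left_inverse matrix_left_invertible_ker by blast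
    then show "\<exists>t. v = t *\<^sub>R w" by auto
  qed
qed

section \<open>Encoding maps of Bregman divergences\<close>

lemma C2_on_gradientI:
  fixes f :: "'a::euclidean_space \<Rightarrow> real"
  assumes "\<And>x. (f has_derivative (\<lambda>v. G x \<bullet> v)) (at x)" and "\<And>x. (G has_derivative G' x) (at x)"
    and "\<And>v. continuous_on UNIV (\<lambda>x. G' x v)"
  shows "C2_on UNIV f"
  unfolding C2_on_def
proof (intro exI conjI ballI)
  show "(f has_derivative blinfun_apply (blinfun_inner_right (G x))) (at x)" for x
    using assms(1) by simp
  show "C1_on UNIV (\<lambda>x. blinfun_inner_right (G x))"
  proof (rule C1_onI)
    show "((\<lambda>x. blinfun_inner_right (G x)) has_derivative (\<lambda>v. blinfun_inner_right (G' x v))) (at x)" for x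
      by (rule bounded_linear.has_derivative[OF bounded_linear_blinfun_inner_right assms(2)])
    show "continuous_on UNIV (\<lambda>x. blinfun_inner_right (G' x v))" for v
      by (rule bounded_linear.continuous_on[OF bounded_linear_blinfun_inner_right assms(3)])
  qed
qed

lemma jacobian_encoding_map:
  fixes \<phi> :: "'n::finite \<Rightarrow> real^'n \<Rightarrow> real"
  assumes "\<And>i. (\<phi> i has_derivative (\<lambda>v. G i \<bullet> v)) (at x)"
  shows "(encoding_map \<phi> has_derivative (\<lambda>v. (\<chi> i. G i) *v v)) (at x)"
    and "jacobian (encoding_map \<phi>) (at x) = (\<chi> i. G i)"
proof -
  show D: "(encoding_map \<phi> has_derivative (\<lambda>v. (\<chi> i. G i) *v v)) (at x)"
  proof (subst has_derivative_componentwise_within, intro ballI)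
    fix b :: "real^'n" assume "b \<in> Basis"
    then obtain i where "b = axis i 1" by (auto simp: Basis_vec_def)
    moreover have "(\<Sum>j\<in>UNIV. G i $ j * v $ j) = G i \<bullet> v" for v
      by (simp add: inner_vec_def)
    ultimately show "((\<lambda>y. encoding_map \<phi> y \<bullet> b) has_derivative (\<lambda>v. ((\<chi> i. G i) *v v) \<bullet> b)) (at x)"
      using assms[of i] by (simp add: inner_axis encoding_map_def matrix_vector_mult_def)
  qed
  show "jacobian (encoding_map \<phi>) (at x) = (\<chi> i. G i)"
    unfolding jacobian_def frechet_derivative_at[OF D, symmetric] by simp
qed

theorem corollary5p5:
  fixes \<rho> :: "real^'n \<Rightarrow> real" and \<epsilon> :: real and \<alpha> :: "'n \<Rightarrow> real^'n"
  assumes "CARD('n) \<ge> 2"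
    and "polyhedral_norm \<rho>"
    and "\<epsilon> > 0"
    and "affinely_independent_family (\<lambda>i. gradient (logsumexp \<rho> \<epsilon>) (\<alpha> i))"
  defines "\<phi> \<equiv> \<lambda>i. bregman (logsumexp \<rho> \<epsilon>) (\<alpha> i)"
  shows "admissible \<phi> \<and>
         (\<forall>x \<in> critical_points \<phi>. fold_nondegenerate \<phi> x) \<and>
         (\<forall>E :: (real^'n) set. rectifiable1 E \<and> hausdorff1 E > 0 \<longrightarrow>
            (\<exists>j. hausdorff1 (\<phi> j ` E) > 0))"
proof -
  interpret exponential_weights "polar_vertices \<rho>" \<epsilon>
    using assms(2,3) by unfold_locales
      (auto intro: finite_polar_vertices polar_vertices_separate simp: polar_vertices_nonempty)
  have F: "(logsumexp \<rho> \<epsilon> has_derivative (\<lambda>v. mean z \<bullet> v)) (at z)" for z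
    unfolding logsumexp_def[abs_def] W_def[symmetric]
    using finite_U U_nonempty by (intro lse_has_derivative) (simp add: card_gt_0_iff)
  \<comment> \<open>The gradient is a definite description, so uniqueness of the derivative is
    needed to evaluate it.\<close>
  have grad: "gradient (logsumexp \<rho> \<epsilon>) z = mean z" for z
    unfolding gradient_def gderiv_def
  proof (rule the_equality)
    show "(logsumexp \<rho> \<epsilon> has_derivative (\<lambda>h. h \<bullet> mean z)) (at z)"
      using F[of z] by (simp add: inner_commute)
    fix D assume "(logsumexp \<rho> \<epsilon> has_derivative (\<lambda>h. h \<bullet> D)) (at z)"
    then have "(\<lambda>h. h \<bullet> D) = (\<lambda>v. mean z \<bullet> v)"
      using F by (rule has_derivative_unique)
    then have "\<forall>h. h \<bullet> D = h \<bullet> mean z" by (metis inner_commute)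
    then show "D = mean z" by (simp add: vector_eq_ldot)
  qed
  define g where "g i = mean (\<alpha> i)" for i
  have "affinely_independent_family g"
    using assms(4) by (simp add: grad g_def[abs_def])
  then obtain w c where w: "w \<noteq> 0" "\<And>i. w \<bullet> g i = c" and det: "\<And>y. det (\<chi> i. y - g i) = w \<bullet> y - c"
    and ker: "\<And>v. (\<And>i j. v \<bullet> g i = v \<bullet> g j) \<Longrightarrow> \<exists>t. v = t *\<^sub>R w"
    by (rule det_affinely_independent_family) blast
  define A where "A x = (\<chi> i. mean x - g i)" for x
  define h where "h x = w \<bullet> mean x - c" for x
  define G where "G x = hess x w" for x
  have D\<phi>: "(\<phi> i has_derivative (\<lambda>v. (mean x - g i) \<bullet> v)) (at x)" for i x
    unfolding \<phi>_def bregman_def[abs_def] grad g_def inner_diff_left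
    by (rule has_derivative_eq_rhs, (rule derivative_intros F)+) (simp add: fun_eq_iff)
  have DH: "(encoding_map \<phi> has_derivative (\<lambda>v. A x *v v)) (at x)"
    and jac: "jacobian (encoding_map \<phi>) (at x) = A x" for x
    unfolding A_def by (rule jacobian_encoding_map[OF D\<phi>])+
  have A_mult: "(A x *v v) $ i = (mean x - g i) \<bullet> v" for x v i
    by (simp add: A_def matrix_vector_mult_def inner_vec_def)
  have Dmean: "((\<lambda>x. mean x - g i) has_derivative hess x) (at x)" for i x
    using has_derivative_diff[OF mean_has_derivative has_derivative_const] by simp
  have C2: "C2_on UNIV (\<phi> i)" for i
    by (rule C2_on_gradientI[OF D\<phi> Dmean continuous_on_hess])
  \<comment> \<open>Symmetry of the Hessian identifies the gradient of \<open>h\<close> at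
    \<open>x\<close> with \<open>hess x w\<close>.\<close>
  have Dh: "(h has_derivative (\<lambda>v. G x \<bullet> v)) (at x)" for x
  proof -
    have "(h has_derivative (\<lambda>v. w \<bullet> hess x v - 0)) (at x)"
      unfolding h_def[abs_def]
      by (intro has_derivative_diff has_derivative_inner_right mean_has_derivative has_derivative_const)
    moreover have "w \<bullet> hess x v = G x \<bullet> v" for v
      using hess_symmetric[of x v w] by (simp add: G_def inner_commute)
    ultimately show ?thesis by simp
  qed
  have contG: "continuous_on UNIV G"
    unfolding G_def by (rule continuous_on_hess)
  have Gw: "G x \<bullet> w > 0" for x
    unfolding G_def by (rule hess_positive_definite[OF w(1)])
  then have G0: "G x \<noteq> 0" for x by (metis inner_zero_left less_irrefl)
  have jdet: "jac_det \<phi> = h"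
    by (rule ext) (simp add: jac_det_def jac A_def det h_def)
  \<comment> \<open>As \<open>CARD('n)\<close> is positive, a rank of at most
    \<open>CARD('n) - 1\<close> is a rank below \<open>CARD('n)\<close>.\<close>
  have "critical_points \<phi> = {x. det (A x) = 0}"
    using assms(1) by (auto simp: critical_points_def jac det_eq_0_rank)
  then have crit: "critical_points \<phi> = {x. h x = 0}"
    by (simp add: A_def det h_def)
  \<comment> \<open>A kernel vector is orthogonal to every \<open>mean x - g i\<close>, so it has
    the same inner product with all \<open>g i\<close>.\<close>
  have kerA: "\<exists>t. v = t *\<^sub>R w" if "A x *v v = 0" for x v
  proof (rule ker)
    have "mean x \<bullet> v = g i \<bullet> v" for i
      using that A_mult[of x v i] by (simp add: inner_diff_left)
    then show "v \<bullet> g i = v \<bullet> g j" for i j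
      by (metis inner_commute)
  qed
  \<comment> \<open>The kernel lies in the line of \<open>w\<close>, which is transversal to the
    hyperplane orthogonal to \<open>G x\<close> because \<open>G x \<bullet> w > 0\<close>.\<close>
  have kerAG: "v = 0" if v: "A x *v v = 0" "G x \<bullet> v = 0" for x v
  proof -
    obtain t where "v = t *\<^sub>R w" using kerA v(1) by blast
    then show ?thesis using v(2) Gw[of x] by simp
  qed
  have tan: "tangent_space {x. h x = 0} x = {v. G x \<bullet> v = 0}" if "h x = 0" for x
    using Dh contG that G0 by (rule tangent_space_level_set)
  \<comment> \<open>Holds at every \<open>x\<close>; it serves both the tangential rank in
    admissibility and the lower bound on the rank at a critical point.\<close>
  have dimT: "dim ((\<lambda>v. A x *v v) ` {v. G x \<bullet> v = 0}) = CARD('n) - 1" for x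
  proof -
    have sub: "subspace {v. G x \<bullet> v = 0}" by (rule subspace_hyperplane)
    have "inj_on ((*v) (A x)) {v. G x \<bullet> v = 0}"
      unfolding linear_injective_on_subspace_0[OF matrix_vector_mul_linear sub] using kerAG by blast
    then have "dim ((*v) (A x) ` {v. G x \<bullet> v = 0}) = dim {v. G x \<bullet> v = 0}"
      by (intro dim_image_eq matrix_vector_mul_linear) (simp add: span_eq_iff[THEN iffD2, OF sub])
    then show ?thesis
      using dim_hyperplane[OF G0[of x]] by simp
  qed
  have "admissible \<phi>"
    unfolding admissible_def
  proof (intro conjI allI exI[of _ "{x. h x = 0}"] ballI)
    show "C1_submanifold (CARD('n) - 1) {x. h x = 0}"
      using C1_submanifold_level_set[OF Dh contG G0] by simp
  qed (simp_all add: C2 crit jac tan dimT)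
  moreover have "fold_nondegenerate \<phi> x" if "x \<in> critical_points \<phi>" for x
    unfolding fold_nondegenerate_def jac
  proof (intro conjI allI impI)
    have "CARD('n) - 1 \<le> dim (range ((*v) (A x)))"
      unfolding dimT[of x, symmetric] by (intro dim_subset image_mono) auto
    then show "rank (A x) = CARD('n) - 1"
      using that by (simp add: critical_points_def jac rank_dim_range)
    fix v assume v: "A x *v v = 0 \<and> v \<noteq> 0"
    have "frechet_derivative (jac_det \<phi>) (at x) = (\<lambda>v. G x \<bullet> v)"
      unfolding jdet by (rule frechet_derivative_at[OF Dh, symmetric])
    then show "frechet_derivative (jac_det \<phi>) (at x) v \<noteq> 0"
      using kerAG v by auto
  qed
  moreover have "\<exists>j. hausdorff1 (\<phi> j ` E) > 0" if E: "rectifiable1 E" "hausdorff1 E > 0" for E :: "(real^'n) set"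
  proof -
    have "C1_on UNIV (encoding_map \<phi>)"
    proof (rule C1_onI[OF DH])
      show "continuous_on UNIV (\<lambda>x. A x *v v)" for v
        unfolding A_def matrix_vector_mult_def
        by (intro continuous_intros continuous_on_mean)
    qed
    moreover have "C1_on UNIV h"
      by (rule C1_onI[OF Dh]) (intro continuous_intros contG)
    moreover have "v = 0" if "h x \<noteq> 0" "A x *v v = 0" for x v
    proof -
      have "invertible (A x)" using that(1) by (simp add: invertible_det_nz A_def det h_def)
      then show ?thesis
        using that(2) unfolding invertible_left_inverse matrix_left_invertible_ker by blast
    qed
    \<comment> \<open>On the zero set of \<open>h\<close>, the vanishing of both derivatives along
      \<open>v\<close> is the hypothesis of \<open>kerAG\<close>; elsewhere \<open>A x\<close> is
      invertible.\<close>
    ultimately have "\<exists>i\<in>Basis. hausdorff1 ((\<lambda>x. encoding_map \<phi> x \<bullet> i) ` E) > 0"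
      using rectifiable1_projection_positive[OF E _ DH _ Dh] kerAG by blast
    then show ?thesis
      by (auto simp: Basis_vec_def inner_axis encoding_map_def)
  qed
  ultimately show ?thesis by blast
qed

end
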